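(* Let $A>0$ and let $c_0:S^1\to\mathbb R^2$ be a non-constant Lipschitz curve parametrized at constant speed, $c_0'(\theta)=\frac{L}{2\pi}e^{i\alpha(\theta)}$ for a.e. $\theta$, where $L$ is the length of $c_0$ and $\alpha:\mathbb R\to\mathbb R$ is a function of locally bounded variation with $\alpha(\theta+2\pi)-\alpha(\theta)\in2\pi\mathbb Z$ (a "1-BV rectifiable curve"). Then $c_0$ lies in the completion of $B_i(S^1,\mathbb R^2)$ with respect to $\mathrm{dist}^{B_i}_{G^A}$: there is a sequence of smooth immersions $c_n$ such that $(\pi(c_n))$ is a Cauchy sequence for $\mathrm{dist}^{B_i}_{G^A}$ and $d_\infty(c_n,c_0)\to0$.
   Context: $S^1=\mathbb R/2\pi\mathbb Z$, $\mathbb R^2\cong\mathbb C$. $\mathrm{Imm}$ is the space of smooth immersions $S^1\to\mathbb R^2$, $B_i(S^1,\mathbb R^2)=\mathrm{Imm}/\mathrm{Diff}(S^1)$ with projection $\pi$. $\ell(c)=\int_{S^1}|c_\theta|d\theta$, $n_c=ic_\theta/|c_\theta|$, $\kappa_c=\det(c_\theta,c_{\theta\theta})/|c_\theta|^3$. For a smooth path $c:[0,1]\times S^1\to\mathbb R^2$ of immersions, $L^{hor}_{G^A}(c)=\int_0^1(\int_{S^1}(1+A\kappa_{c(t)}^2)\langle c_t,n_{c(t)}\rangle^2|c_\theta|d\theta)^{1/2}dt$; $\mathrm{dist}^{B_i}_{G^A}(C_0,C_1)$ is the infimum of $L^{hor}_{G^A}(c)$ over such paths with $\pi(c(0,\cdot))=C_0,\pi(c(1,\cdot))=C_1$.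 For continuous curves $c,d:S^1\to\mathbb R^2$, the Fréchet distance is $d_\infty(c,d)=\inf_h\|c\circ h-d\|_\infty$ over homeomorphisms $h$ of $S^1$. *)

theory Defs
  imports "HOL-Analysis.Analysis"
begin

text \<open>Curves S^1 \<rightarrow> R^2 are represented as 2pi-periodic maps real \<Rightarrow> complex.\<close>

definition periodic2pi :: "(real \<Rightarrow> 'a) \<Rightarrow> bool" where
  "periodic2pi c \<longleftrightarrow> (\<forall>\<theta>. c (\<theta> + 2*pi) = c \<theta>)"

text \<open>C^infinity on an open set S, one real variable: f lies in a family of functions
  closed under differentiation, all of which are differentiable on S.\<close>
definition smooth1_on :: "real set \<Rightarrow> (real \<Rightarrow> 'a::real_normed_vector) \<Rightarrow> bool" where
  "smooth1_on S f \<longleftrightarrow> (\<exists>F. f \<in> F \<and> (\<forall>g\<in>F. continuous_on S g \<and>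
      (\<exists>g'\<in>F. \<forall>x\<in>S. (g has_vector_derivative g' x) (at x))))"

text \<open>C^infinity on an open set S of R^2 (two real variables): all iterated partial
  derivatives exist and are continuous.\<close>
definition smooth2_on :: "(real \<times> real) set \<Rightarrow> (real \<Rightarrow> real \<Rightarrow> 'a::real_normed_vector) \<Rightarrow> bool" where
  "smooth2_on S f \<longleftrightarrow> (\<exists>F. f \<in> F \<and> (\<forall>g\<in>F. continuous_on S (\<lambda>(s,t). g s t) \<and>
      (\<exists>g1\<in>F. \<forall>(s,t)\<in>S. ((\<lambda>s'. g s' t) has_vector_derivative g1 s t) (at s)) \<and>
      (\<exists>g2\<in>F. \<forall>(s,t)\<in>S. ((\<lambda>t'. g s t') has_vector_derivative g2 s t) (at t))))"

definition smooth_immersion :: "(real \<Rightarrow> complex) \<Rightarrow> bool" where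
  "smooth_immersion c \<longleftrightarrow> periodic2pi c \<and> smooth1_on UNIV c \<and>
     (\<forall>\<theta>. vector_derivative c (at \<theta>) \<noteq> 0)"

text \<open>Diff(S^1), via lifts to R.\<close>
definition diff_S1 :: "(real \<Rightarrow> real) set" where
  "diff_S1 = {\<phi>. smooth1_on UNIV \<phi> \<and> (\<forall>x. deriv \<phi> x \<noteq> 0) \<and>
      ((\<forall>x. \<phi> (x + 2*pi) = \<phi> x + 2*pi) \<or> (\<forall>x. \<phi> (x + 2*pi) = \<phi> x - 2*pi))}"

text \<open>The fibre pi^{-1}(pi(c)) of the projection Imm \<rightarrow> B_i.\<close>
definition orbit :: "(real \<Rightarrow> complex) \<Rightarrow> (real \<Rightarrow> complex) set" where
  "orbit c = {c \<circ> \<phi> | \<phi>. \<phi> \<in> diff_S1}"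

text \<open>Smooth paths [0,1] \<rightarrow> Imm, c t \<theta>.  Smoothness on [0,1] x S^1 is taken as smoothness
  on an open neighbourhood T x R of it.\<close>
definition smooth_imm_path :: "(real \<Rightarrow> real \<Rightarrow> complex) \<Rightarrow> bool" where
  "smooth_imm_path c \<longleftrightarrow> (\<exists>T. open T \<and> {0..1} \<subseteq> T \<and> smooth2_on (T \<times> UNIV) c) \<and>
     (\<forall>t\<in>{0..1}. smooth_immersion (c t))"

definition detC :: "complex \<Rightarrow> complex \<Rightarrow> real" where
  "detC a b = Re a * Im b - Im a * Re b"

definition d_theta :: "(real \<Rightarrow> real \<Rightarrow> complex) \<Rightarrow> real \<Rightarrow> real \<Rightarrow> complex" where
  "d_theta c t \<theta> = vector_derivative (\<lambda>\<theta>'. c t \<theta>') (at \<theta>)"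

definition d_t :: "(real \<Rightarrow> real \<Rightarrow> complex) \<Rightarrow> real \<Rightarrow> real \<Rightarrow> complex" where
  "d_t c t \<theta> = vector_derivative (\<lambda>t'. c t' \<theta>) (at t)"

definition normal :: "(real \<Rightarrow> real \<Rightarrow> complex) \<Rightarrow> real \<Rightarrow> real \<Rightarrow> complex" where
  "normal c t \<theta> = \<i> * d_theta c t \<theta> / complex_of_real (cmod (d_theta c t \<theta>))"

definition curvature :: "(real \<Rightarrow> real \<Rightarrow> complex) \<Rightarrow> real \<Rightarrow> real \<Rightarrow> real" where
  "curvature c t \<theta> = detC (d_theta c t \<theta>) (d_theta (d_theta c) t \<theta>) / cmod (d_theta c t \<theta>) ^ 3"

definition L_hor :: "real \<Rightarrow> (real \<Rightarrow> real \<Rightarrow> complex) \<Rightarrow> real" where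
  "L_hor A c = integral {0..1} (\<lambda>t. sqrt (integral {0..2*pi} (\<lambda>\<theta>.
      (1 + A * (curvature c t \<theta>)\<^sup>2) * (inner (d_t c t \<theta>) (normal c t \<theta>))\<^sup>2
        * cmod (d_theta c t \<theta>))))"

text \<open>dist^{B_i}_{G^A}(pi c0, pi c1), as an extended real (infimum of the empty set = \<infinity>).\<close>
definition dist_GA :: "real \<Rightarrow> (real \<Rightarrow> complex) \<Rightarrow> (real \<Rightarrow> complex) \<Rightarrow> ereal" where
  "dist_GA A c0 c1 = Inf {ereal (L_hor A p) | p. smooth_imm_path p \<and>
      p 0 \<in> orbit c0 \<and> p 1 \<in> orbit c1}"

text \<open>Frechet distance; homeomorphisms of S^1 = unit circle in C, a 2pi-periodic curve c
  is read as the map z \<mapsto> c (Arg z) on the circle.\<close>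
definition frechet_dist :: "(real \<Rightarrow> complex) \<Rightarrow> (real \<Rightarrow> complex) \<Rightarrow> real" where
  "frechet_dist c d = (INF h \<in> {h. \<exists>h'. homeomorphism (sphere 0 1) (sphere 0 1) h h'}.
      (SUP \<theta>. cmod (c (Arg (h (cis \<theta>))) - d \<theta>)))"

definition bv_on :: "(real \<Rightarrow> real) \<Rightarrow> real \<Rightarrow> real \<Rightarrow> bool" where
  "bv_on f a b \<longleftrightarrow> (\<exists>M. \<forall>xs. sorted xs \<and> set xs \<subseteq> {a..b} \<longrightarrow>
      (\<Sum>i < length xs - 1. \<bar>f (xs ! Suc i) - f (xs ! i)\<bar>) \<le> M)"

definition locally_bv :: "(real \<Rightarrow> real) \<Rightarrow> bool" where
  "locally_bv f \<longleftrightarrow> (\<forall>a b. bv_on f a b)"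

end

theory Submission
  imports Defs
begin

text \<open>Replace the turning angle by its \<open>2\<pi>\<close>-periodic version \<open>\<beta>\<close>, which has bounded
  variation on a period, and let \<open>\<alpha>\<^sub>k\<close> interpolate \<open>\<beta>\<close> smoothly at \<open>4\<^sup>k\<close> equidistant nodes.  Then
  \<open>\<alpha>\<^sub>k\<^sub>+\<^sub>1 - \<alpha>\<^sub>k\<close> has \<open>L\<^sup>1\<close> norm \<open>O(4\<^sup>-\<^sup>k)\<close> while the squared \<open>L\<^sup>2\<close> norm of \<open>\<alpha>\<^sub>k'\<close>, which controls
  the curvature, is \<open>O(4\<^sup>k)\<close>.  Interpolating also between consecutive \<open>\<alpha>\<^sub>k\<close> gives a single smooth
  family of angles indexed by a real parameter \<open>s\<close>; integrating the unit tangents, after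
  subtracting their mean, gives a smooth family of closed curves whose horizontal speed is
  \<open>O((4\<^sup>-\<^sup>2\<^sup>s \<cdot> 4\<^sup>s)\<^sup>1\<^sup>/\<^sup>2) = O(2\<^sup>-\<^sup>s)\<close>.  This is integrable in \<open>s\<close>, so the curves with integer
  parameter form a Cauchy sequence; any two of them are joined by a segment of the same family, so
  neither concatenation of paths nor the triangle inequality is needed.\<close>

section \<open>Smooth functions of two variables\<close>

text \<open>The obstacle is that the angle may jump, so the curvature energy of smooth
  approximations may blow up; the displacement has to decay faster than this energy grows. Both
  rates come from one partition of the period into N cells, where \<beta> oscillates by at most
  \<open>var N k\<close> and these numbers add up to \<open>total\<close>. An L^1 error is the cell
  length 2 pi / N times that sum. Slopes of size N * \<open>var N k\<close> have a squared L^2 norm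
  of order N, because the squares add up to at most \<open>total\<close> squared. The velocity
  enters the metric squared, so N^-2 * N = N^-1 remains, and its root is summable along powers of 4;
  the base 4 makes the root a power of 2. Periodising the angle turns its increment over a period
  into a jump at the multiples of 2 pi, which the interpolation makes up within one cell. Hence all
  approximating immersions have turning number zero, whatever the increment of \<alpha> is. The mean
  of the tangent is small because \<open>c0\<close> closes up, so the closing correction neither
  moves the curve far nor lets its speed vanish at high levels.\<close>

lemma smooth2_coinduct:
  assumes "f \<in> F"
    and "\<And>g. g \<in> F \<Longrightarrow> continuous_on UNIV (\<lambda>(s,t). g s t)"
    and "\<And>g. g \<in> F \<Longrightarrow> \<exists>g1\<in>F. \<forall>s t. ((\<lambda>s'. g s' t) has_vector_derivative g1 s t) (at s)"
    and "\<And>g. g \<in> F \<Longrightarrow> \<exists>g2\<in>F. \<forall>s t. ((\<lambda>t'. g s t') has_vector_derivative g2 s t) (at t)"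
  shows "smooth2_on UNIV f"
  unfolding smooth2_on_def using assms by (intro exI[of _ F]) auto

text \<open>The family that witnesses smoothness of \<open>f\<close> also witnesses it for each of
  its members, so the partial derivatives are smooth again and the class of all smooth functions can
  serve as a coinduction family.\<close>

lemma smooth2_elim:
  assumes "smooth2_on UNIV f"
  shows "continuous_on UNIV (\<lambda>(s,t). f s t)"
    and "\<exists>f1. smooth2_on UNIV f1 \<and> (\<forall>s t. ((\<lambda>s'. f s' t) has_vector_derivative f1 s t) (at s))"
    and "\<exists>f2. smooth2_on UNIV f2 \<and> (\<forall>s t. ((\<lambda>t'. f s t') has_vector_derivative f2 s t) (at t))"
proof -
  obtain F where F: "f \<in> F" "\<forall>g\<in>F. continuous_on UNIV (\<lambda>(s,t). g s t) \<and>
      (\<exists>g1\<in>F. \<forall>(s,t)\<in>UNIV. ((\<lambda>s'. g s' t) has_vector_derivative g1 s t) (at s)) \<and>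
      (\<exists>g2\<in>F. \<forall>(s,t)\<in>UNIV. ((\<lambda>t'. g s t') has_vector_derivative g2 s t) (at t))"
    using assms unfolding smooth2_on_def by blast
  have sm: "smooth2_on UNIV g" if "g \<in> F" for g
    unfolding smooth2_on_def using F that by (intro exI[of _ F]) auto
  show "continuous_on UNIV (\<lambda>(s,t). f s t)" using F by blast
  show "\<exists>f1. smooth2_on UNIV f1 \<and> (\<forall>s t. ((\<lambda>s'. f s' t) has_vector_derivative f1 s t) (at s))"
  proof -
    obtain f1 where "f1 \<in> F" "\<forall>(s,t)\<in>UNIV. ((\<lambda>s'. f s' t) has_vector_derivative f1 s t) (at s)"
      using F by blast
    then show ?thesis using sm by (intro exI[of _ f1]) auto
  qed
  show "\<exists>f2. smooth2_on UNIV f2 \<and> (\<forall>s t. ((\<lambda>t'. f s t') has_vector_derivative f2 s t) (at t))"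
  proof -
    obtain f2 where "f2 \<in> F" "\<forall>(s,t)\<in>UNIV. ((\<lambda>t'. f s t') has_vector_derivative f2 s t) (at t)"
      using F by blast
    then show ?thesis using sm by (intro exI[of _ f2]) auto
  qed
qed

inductive_set algebra_hull ::
    "(real \<Rightarrow> real \<Rightarrow> 'a::real_normed_algebra_1) set \<Rightarrow> (real \<Rightarrow> real \<Rightarrow> 'a) set" for F where
  base: "f \<in> F \<Longrightarrow> f \<in> algebra_hull F"
| const: "(\<lambda>s t. z) \<in> algebra_hull F"
| add: "f \<in> algebra_hull F \<Longrightarrow> g \<in> algebra_hull F \<Longrightarrow> (\<lambda>s t. f s t + g s t) \<in> algebra_hull F"
| mult: "f \<in> algebra_hull F \<Longrightarrow> g \<in> algebra_hull F \<Longrightarrow> (\<lambda>s t. f s t * g s t) \<in> algebra_hull F"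

text \<open>Coinduction up to the algebra operations: by the sum and product rules it suffices that the
  partial derivatives of the members of \<open>F\<close> lie in the algebra generated by \<open>F\<close>.\<close>
lemma smooth2_coinduct_algebra:
  fixes f :: "real \<Rightarrow> real \<Rightarrow> 'a::real_normed_algebra_1"
  assumes "f \<in> algebra_hull F"
    and c: "\<And>g. g \<in> F \<Longrightarrow> continuous_on UNIV (\<lambda>(s,t). g s t)"
    and d1: "\<And>g. g \<in> F \<Longrightarrow> \<exists>g1\<in>algebra_hull F. \<forall>s t. ((\<lambda>s'. g s' t) has_vector_derivative g1 s t) (at s)"
    and d2: "\<And>g. g \<in> F \<Longrightarrow> \<exists>g2\<in>algebra_hull F. \<forall>s t. ((\<lambda>t'. g s t') has_vector_derivative g2 s t) (at t)"
  shows "smooth2_on UNIV f"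
proof (rule smooth2_coinduct[OF assms(1)])
  fix g assume "g \<in> algebra_hull F"
  then show "continuous_on UNIV (\<lambda>(s,t). g s t)"
  proof induction
    case (base f) then show ?case by (rule c)
  qed (auto simp: split_beta intro!: continuous_intros)
next
  fix g assume "g \<in> algebra_hull F"
  then show "\<exists>g1\<in>algebra_hull F. \<forall>s t. ((\<lambda>s'. g s' t) has_vector_derivative g1 s t) (at s)"
  proof induction
    case (base f) then show ?case using d1 by blast
  next
    case (const z)
    show ?case by (rule bexI[of _ "\<lambda>s t. 0"]) (auto intro: algebra_hull.const)
  next
    case (add f g)
    then obtain f1 g1 where "f1 \<in> algebra_hull F" "g1 \<in> algebra_hull F"
      "\<forall>s t. ((\<lambda>s'. f s' t) has_vector_derivative f1 s t) (at s)"
      "\<forall>s t. ((\<lambda>s'. g s' t) has_vector_derivative g1 s t) (at s)" by blast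
    then show ?case
      by (intro bexI[of _ "\<lambda>s t. f1 s t + g1 s t"])
        (auto intro!: algebra_hull.add derivative_intros)
  next
    case (mult f g)
    then obtain f1 g1 where "f1 \<in> algebra_hull F" "g1 \<in> algebra_hull F"
      "\<forall>s t. ((\<lambda>s'. f s' t) has_vector_derivative f1 s t) (at s)"
      "\<forall>s t. ((\<lambda>s'. g s' t) has_vector_derivative g1 s t) (at s)" by blast
    then show ?case using mult.hyps
      by (intro bexI[of _ "\<lambda>s t. f s t * g1 s t + f1 s t * g s t"])
        (auto intro!: algebra_hull.add algebra_hull.mult has_vector_derivative_mult)
  qed
next
  fix g assume "g \<in> algebra_hull F"
  then show "\<exists>g2\<in>algebra_hull F. \<forall>s t. ((\<lambda>t'. g s t') has_vector_derivative g2 s t) (at t)"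
  proof induction
    case (base f) then show ?case using d2 by blast
  next
    case (const z)
    show ?case by (rule bexI[of _ "\<lambda>s t. 0"]) (auto intro: algebra_hull.const)
  next
    case (add f g)
    then obtain f1 g1 where "f1 \<in> algebra_hull F" "g1 \<in> algebra_hull F"
      "\<forall>s t. ((\<lambda>t'. f s t') has_vector_derivative f1 s t) (at t)"
      "\<forall>s t. ((\<lambda>t'. g s t') has_vector_derivative g1 s t) (at t)" by blast
    then show ?case
      by (intro bexI[of _ "\<lambda>s t. f1 s t + g1 s t"])
        (auto intro!: algebra_hull.add derivative_intros)
  next
    case (mult f g)
    then obtain f1 g1 where "f1 \<in> algebra_hull F" "g1 \<in> algebra_hull F"
      "\<forall>s t. ((\<lambda>t'. f s t') has_vector_derivative f1 s t) (at t)"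
      "\<forall>s t. ((\<lambda>t'. g s t') has_vector_derivative g1 s t) (at t)" by blast
    then show ?case using mult.hyps
      by (intro bexI[of _ "\<lambda>s t. f s t * g1 s t + f1 s t * g s t"])
        (auto intro!: algebra_hull.add algebra_hull.mult has_vector_derivative_mult)
  qed
qed

text \<open>The class of smooth functions contains its own partial derivatives, so it qualifies as
  the generating family; sums and products then come for free.\<close>

lemma smooth2_algebra_hull:
  fixes f :: "real \<Rightarrow> real \<Rightarrow> 'a::real_normed_algebra_1"
  assumes "f \<in> algebra_hull {g. smooth2_on UNIV g}"
  shows "smooth2_on UNIV f"
  using assms
proof (rule smooth2_coinduct_algebra)
  fix g :: "real \<Rightarrow> real \<Rightarrow> 'a" assume "g \<in> {g. smooth2_on UNIV g}"
  then have g: "smooth2_on UNIV g" by simp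
  show "continuous_on UNIV (\<lambda>(s,t). g s t)" by (rule smooth2_elim(1)[OF g])
  show "\<exists>g1\<in>algebra_hull {g. smooth2_on UNIV g}.
      \<forall>s t. ((\<lambda>s'. g s' t) has_vector_derivative g1 s t) (at s)"
    using smooth2_elim(2)[OF g] by (auto intro: algebra_hull.base)
  show "\<exists>g2\<in>algebra_hull {g. smooth2_on UNIV g}.
      \<forall>s t. ((\<lambda>t'. g s t') has_vector_derivative g2 s t) (at t)"
    using smooth2_elim(3)[OF g] by (auto intro: algebra_hull.base)
qed

section \<open>Closure properties of the smooth functions of two variables\<close>

named_theorems smooth2_intros

context
  fixes f g :: "real \<Rightarrow> real \<Rightarrow> 'a::real_normed_algebra_1"
  assumes fg: "smooth2_on UNIV f" "smooth2_on UNIV g"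
begin

lemma smooth2_add [smooth2_intros]: "smooth2_on UNIV (\<lambda>s t. f s t + g s t)"
  using fg by (intro smooth2_algebra_hull algebra_hull.add; intro algebra_hull.base CollectI)

lemma smooth2_mult [smooth2_intros]: "smooth2_on UNIV (\<lambda>s t. f s t * g s t)"
  using fg by (intro smooth2_algebra_hull algebra_hull.mult; intro algebra_hull.base CollectI)

end

lemma smooth2_const [smooth2_intros]: "smooth2_on UNIV (\<lambda>s t. z)"
  by (rule smooth2_coinduct[of _ "{\<lambda>s t. z, \<lambda>s t. 0}"]) auto

lemma smooth2_diff [smooth2_intros]:
  fixes f g :: "real \<Rightarrow> real \<Rightarrow> 'a::real_normed_algebra_1"
  assumes "smooth2_on UNIV f" "smooth2_on UNIV g"
  shows "smooth2_on UNIV (\<lambda>s t. f s t - g s t)"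
  using smooth2_add[OF assms(1) smooth2_mult[OF smooth2_const[of "-1"] assms(2)]] by simp

lemma smooth2_fst [smooth2_intros]: "smooth2_on UNIV (\<lambda>s t. s)"
  by (rule smooth2_coinduct[of _ "{\<lambda>s t. s, \<lambda>s t. 1, \<lambda>s t. 0}"])
    (auto simp: split_beta intro!: derivative_eq_intros continuous_intros)

lemma smooth2_snd [smooth2_intros]: "smooth2_on UNIV (\<lambda>s t. t)"
  by (rule smooth2_coinduct[of _ "{\<lambda>s t. t, \<lambda>s t. 1, \<lambda>s t. 0}"])
    (auto simp: split_beta intro!: derivative_eq_intros continuous_intros)

lemma smooth2_bounded_linear:
  assumes T: "bounded_linear T" and f: "smooth2_on UNIV f"
  shows "smooth2_on UNIV (\<lambda>s t. T (f s t))"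
proof (rule smooth2_coinduct[of _ "{\<lambda>s t. T (f s t) |f. smooth2_on UNIV f}"], goal_cases)
  case 1 then show ?case using f by blast
next
  case (2 g)
  then obtain f where "g = (\<lambda>s t. T (f s t))" "smooth2_on UNIV f" by blast
  then show ?case using smooth2_elim(1)[of f] bounded_linear.continuous_on[OF T]
    by (auto simp: split_beta)
next
  case (3 g)
  then obtain f where f: "g = (\<lambda>s t. T (f s t))" "smooth2_on UNIV f" by blast
  obtain f' where f': "smooth2_on UNIV f'" "\<And>s t. ((\<lambda>s'. f s' t) has_vector_derivative f' s t) (at s)"
    using smooth2_elim(2)[OF f(2)] by blast
  show ?case unfolding f
    by (rule bexI[of _ "\<lambda>s t. T (f' s t)"])
      (use f' in \<open>auto intro!: bounded_linear.has_vector_derivative[OF T]\<close>)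
next
  case (4 g)
  then obtain f where f: "g = (\<lambda>s t. T (f s t))" "smooth2_on UNIV f" by blast
  obtain f' where f': "smooth2_on UNIV f'" "\<And>s t. ((\<lambda>t'. f s t') has_vector_derivative f' s t) (at t)"
    using smooth2_elim(3)[OF f(2)] by blast
  show ?case unfolding f
    by (rule bexI[of _ "\<lambda>s t. T (f' s t)"])
      (use f' in \<open>auto intro!: bounded_linear.has_vector_derivative[OF T]\<close>)
qed

lemma smooth2_of_real [smooth2_intros]:
  "smooth2_on UNIV f \<Longrightarrow> smooth2_on UNIV (\<lambda>s t. of_real (f s t) :: 'a::real_normed_algebra_1)"
  by (rule smooth2_bounded_linear[OF bounded_linear_of_real])

lemma smooth1_elim:
  assumes "smooth1_on UNIV f"
  shows "continuous_on UNIV f"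
    and "\<exists>f'. smooth1_on UNIV f' \<and> (\<forall>x. (f has_vector_derivative f' x) (at x))"
  using assms unfolding smooth1_on_def by blast+

text \<open>The chain rule yields \<open>f'\<close> at \<open>h\<close> times a partial derivative
  of \<open>h\<close>: the first factor is again a composition with \<open>h\<close>, the second is
  smooth, so the mixed family is closed up to products.\<close>

lemma smooth2_compose:
  fixes f :: "real \<Rightarrow> 'a::real_normed_algebra_1"
  assumes f: "smooth1_on UNIV f" and h: "smooth2_on UNIV h"
  shows "smooth2_on UNIV (\<lambda>s t. f (h s t))"
proof -
  let ?F = "{\<lambda>s t. f (h s t) |f. smooth1_on UNIV f} \<union> {g::real \<Rightarrow> real \<Rightarrow> 'a. smooth2_on UNIV g}"
  show ?thesis
  proof (rule smooth2_coinduct_algebra[of _ ?F], goal_cases)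
    case 1 then show ?case using f by (auto intro!: algebra_hull.base)
  next
    case (2 g)
    then consider f where "g = (\<lambda>s t. f (h s t))" "smooth1_on UNIV f" | "smooth2_on UNIV g" by blast
    then show ?case
    proof cases
      case 1
      have "continuous_on UNIV (\<lambda>p. f ((\<lambda>(s,t). h s t) p))"
        by (rule continuous_on_compose2[OF smooth1_elim(1)[OF 1(2)] smooth2_elim(1)[OF h]]) auto
      then show ?thesis using 1 by (simp add: split_beta)
    qed (rule smooth2_elim(1))
  next
    case (3 g)
    then consider f where "g = (\<lambda>s t. f (h s t))" "smooth1_on UNIV f" | "smooth2_on UNIV g" by blast
    then show ?case
    proof cases
      case 1
      obtain f' where f': "smooth1_on UNIV f'" "\<And>x. (f has_vector_derivative f' x) (at x)"
        using smooth1_elim(2)[OF 1(2)] by blast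
      obtain h1 where h1: "smooth2_on UNIV h1" "\<And>s t. ((\<lambda>s. h s t) has_vector_derivative h1 s t) (at s)"
        using smooth2_elim(2)[OF h] by blast
      have "((\<lambda>s. g s t) has_vector_derivative (of_real (h1 s t) * f' (h s t))) (at s)" for s t
        using vector_diff_chain_at[OF h1(2) f'(2), of t s] 1(1)
        by (simp add: o_def scaleR_conv_of_real)
      moreover have "(\<lambda>s t. of_real (h1 s t) * f' (h s t)) \<in> algebra_hull ?F"
        using f'(1) smooth2_of_real[OF h1(1)] by (intro algebra_hull.mult algebra_hull.base) auto
      ultimately show ?thesis by (intro bexI) auto
    next
      case 2
      then show ?thesis using smooth2_elim(2)[OF 2] by (auto intro!: algebra_hull.base)
    qed
  next
    case (4 g)
    then consider f where "g = (\<lambda>s t. f (h s t))" "smooth1_on UNIV f" | "smooth2_on UNIV g" by blast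
    then show ?case
    proof cases
      case 1
      obtain f' where f': "smooth1_on UNIV f'" "\<And>x. (f has_vector_derivative f' x) (at x)"
        using smooth1_elim(2)[OF 1(2)] by blast
      obtain h1 where h1: "smooth2_on UNIV h1" "\<And>s t. ((\<lambda>t. h s t) has_vector_derivative h1 s t) (at t)"
        using smooth2_elim(3)[OF h] by blast
      have "((\<lambda>t. g s t) has_vector_derivative (of_real (h1 s t) * f' (h s t))) (at t)" for s t
        using vector_diff_chain_at[OF h1(2) f'(2), of s t] 1(1)
        by (simp add: o_def scaleR_conv_of_real)
      moreover have "(\<lambda>s t. of_real (h1 s t) * f' (h s t)) \<in> algebra_hull ?F"
        using f'(1) smooth2_of_real[OF h1(1)] by (intro algebra_hull.mult algebra_hull.base) auto
      ultimately show ?thesis by (intro bexI) auto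
    next
      case 2
      then show ?thesis using smooth2_elim(3)[OF 2] by (auto intro!: algebra_hull.base)
    qed
  qed
qed

lemma smooth1_exp_i: "smooth1_on UNIV (\<lambda>x::real. exp (\<i> * complex_of_real x))"
  unfolding smooth1_on_def
proof (intro exI[of _ "{\<lambda>x. z * exp (\<i> * complex_of_real x) |z. True}"] conjI ballI)
  show "(\<lambda>x. exp (\<i> * complex_of_real x)) \<in> {\<lambda>x. z * exp (\<i> * complex_of_real x) |z. True}"
    by (auto intro!: exI[of _ 1])
  fix g assume "g \<in> {\<lambda>x. z * exp (\<i> * complex_of_real x) |z. True}"
  then obtain z where g: "g = (\<lambda>x. z * exp (\<i> * complex_of_real x))" by blast
  show "continuous_on UNIV g" unfolding g by (intro continuous_intros)
  have "(g has_vector_derivative (z * \<i>) * exp (\<i> * complex_of_real x)) (at x)" for x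
    unfolding g by (rule has_vector_derivative_real_field) (auto intro!: derivative_eq_intros)
  then show "\<exists>g'\<in>{\<lambda>x. z * exp (\<i> * complex_of_real x) |z. True}. \<forall>x\<in>UNIV. (g has_vector_derivative g' x) (at x)"
    by (intro bexI[of _ "\<lambda>x. (z * \<i>) * exp (\<i> * complex_of_real x)"]) auto
qed

lemma smooth2_exp_i [smooth2_intros]:
  "smooth2_on UNIV h \<Longrightarrow> smooth2_on UNIV (\<lambda>s t. exp (\<i> * complex_of_real (h s t)))"
  by (rule smooth2_compose[OF smooth1_exp_i])

text \<open>Needed for functions defined piecewise through a floor. Local smoothness passes to
  partial derivatives because the globally chosen \<open>vector_derivative\<close> coincides on each
  open \<open>U\<close> with that of the local model \<open>g\<close>.\<close>

lemma smooth2_local: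
  assumes "\<And>s t. \<exists>U g. open U \<and> (s,t) \<in> U \<and> smooth2_on UNIV g \<and> (\<forall>(s',t')\<in>U. f s' t' = g s' t')"
  shows "smooth2_on UNIV f"
proof -
  let ?P = "\<lambda>f s t U g. open U \<and> (s,t) \<in> U \<and> smooth2_on UNIV g \<and> (\<forall>(s',t')\<in>U. f s' t' = g s' t')"
  let ?F = "{f. \<forall>s t. \<exists>U g. ?P f s t U g}"
  have d1: "((\<lambda>s. f s t) has_vector_derivative d) (at s)"
    if "open U" "(s,t) \<in> U" "\<forall>(s',t')\<in>U. f s' t' = g s' t'"
      and d: "((\<lambda>s. g s t) has_vector_derivative d) (at s)" for f g :: "real \<Rightarrow> real \<Rightarrow> 'a" and U s t d
  proof -
    have "open ((\<lambda>s. (s,t)) -` U)" using that(1) by (intro open_vimage continuous_intros)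
    then show ?thesis
      using that by (intro has_vector_derivative_transform_within_open[OF d, where S="(\<lambda>s. (s,t)) -` U"]) auto
  qed
  have d2: "((\<lambda>t. f s t) has_vector_derivative d) (at t)"
    if "open U" "(s,t) \<in> U" "\<forall>(s',t')\<in>U. f s' t' = g s' t'"
      and d: "((\<lambda>t. g s t) has_vector_derivative d) (at t)" for f g :: "real \<Rightarrow> real \<Rightarrow> 'a" and U s t d
  proof -
    have "open ((\<lambda>t. (s,t)) -` U)" using that(1) by (intro open_vimage continuous_intros)
    then show ?thesis
      using that by (intro has_vector_derivative_transform_within_open[OF d, where S="(\<lambda>t. (s,t)) -` U"]) auto
  qed
  show ?thesis
  proof (rule smooth2_coinduct[of _ ?F], goal_cases)
    case 1 show ?case using assms by blast
  next
    case (2 f)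
    show ?case unfolding continuous_on_eq_continuous_at[OF open_UNIV]
    proof (intro ballI)
      fix x :: "real \<times> real"
      obtain U g where g: "?P f (fst x) (snd x) U g" using 2 by blast
      have "isCont (\<lambda>(s,t). g s t) x"
        using smooth2_elim(1)[of g] g by (cases x) (simp add: continuous_on_eq_continuous_at)
      moreover have "\<forall>\<^sub>F y in nhds x. (\<lambda>(s,t). f s t) y = (\<lambda>(s,t). g s t) y"
        using g by (auto simp: eventually_nhds intro!: exI[of _ U])
      ultimately show "isCont (\<lambda>(s,t). f s t) x" by (subst isCont_cong)
    qed
  next
    case (3 f)
    define f' where "f' s t = vector_derivative (\<lambda>s. f s t) (at s)" for s t
    have *: "((\<lambda>s. f s t) has_vector_derivative f' s t) (at s) \<and>
      (\<exists>U g. open U \<and> (s,t) \<in> U \<and> smooth2_on UNIV g \<and> (\<forall>(s',t')\<in>U. f' s' t' = g s' t'))" for s t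
    proof -
      obtain U g where U: "open U" "(s,t) \<in> U" and g: "smooth2_on UNIV g"
        and eq: "\<forall>(s',t')\<in>U. f s' t' = g s' t'" using 3 by blast
      obtain g' where g': "smooth2_on UNIV g'" "\<And>s t. ((\<lambda>s. g s t) has_vector_derivative g' s t) (at s)"
        using smooth2_elim(2)[OF g] by blast
      have D: "((\<lambda>s. f s t) has_vector_derivative g' s t) (at s)" if "(s,t) \<in> U" for s t
        by (rule d1[OF U(1) that eq g'(2)])
      have e: "f' s t = g' s t" if "(s,t) \<in> U" for s t
        unfolding f'_def by (rule vector_derivative_at[OF D[OF that]])
      have "\<forall>(s',t')\<in>U. f' s' t' = g' s' t'" using e by blast
      then have "\<exists>U g. open U \<and> (s,t) \<in> U \<and> smooth2_on UNIV g \<and> (\<forall>(s',t')\<in>U. f' s' t' = g s' t')"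
        using U g'(1) by blast
      with D[OF U(2)] e[OF U(2)] show ?thesis by (simp only: simp_thms)
    qed
    have "f' \<in> ?F" using * by blast
    moreover note conjunct1[OF *]
    ultimately show ?case by (intro bexI[of _ f'] allI)
  next
    case (4 f)
    define f' where "f' s t = vector_derivative (\<lambda>t. f s t) (at t)" for s t
    have *: "((\<lambda>t. f s t) has_vector_derivative f' s t) (at t) \<and>
      (\<exists>U g. open U \<and> (s,t) \<in> U \<and> smooth2_on UNIV g \<and> (\<forall>(s',t')\<in>U. f' s' t' = g s' t'))" for s t
    proof -
      obtain U g where U: "open U" "(s,t) \<in> U" and g: "smooth2_on UNIV g"
        and eq: "\<forall>(s',t')\<in>U. f s' t' = g s' t'" using 4 by blast
      obtain g' where g': "smooth2_on UNIV g'" "\<And>s t. ((\<lambda>t. g s t) has_vector_derivative g' s t) (at t)"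
        using smooth2_elim(3)[OF g] by blast
      have D: "((\<lambda>t. f s t) has_vector_derivative g' s t) (at t)" if "(s,t) \<in> U" for s t
        by (rule d2[OF U(1) that eq g'(2)])
      have e: "f' s t = g' s t" if "(s,t) \<in> U" for s t
        unfolding f'_def by (rule vector_derivative_at[OF D[OF that]])
      have "\<forall>(s',t')\<in>U. f' s' t' = g' s' t'" using e by blast
      then have "\<exists>U g. open U \<and> (s,t) \<in> U \<and> smooth2_on UNIV g \<and> (\<forall>(s',t')\<in>U. f' s' t' = g s' t')"
        using U g'(1) by blast
      with D[OF U(2)] e[OF U(2)] show ?thesis by (simp only: simp_thms)
    qed
    have "f' \<in> ?F" using * by blast
    moreover note conjunct1[OF *]
    ultimately show ?case by (intro bexI[of _ f'] allI)
  qed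
qed

lemma smooth2_imp_smooth1:
  assumes "smooth2_on UNIV f" shows "smooth1_on UNIV (f s)"
  unfolding smooth1_on_def
proof (intro exI[of _ "{g s |g. smooth2_on UNIV g}"] conjI ballI)
  show "f s \<in> {g s |g. smooth2_on UNIV g}" using assms by blast
  fix k assume "k \<in> {g s |g. smooth2_on UNIV g}"
  then obtain g where g: "k = g s" "smooth2_on UNIV g" by blast
  have "continuous_on UNIV (\<lambda>t. (\<lambda>(s,t). g s t) (s,t))"
    by (rule continuous_on_compose2[OF smooth2_elim(1)[OF g(2)]]) (auto intro!: continuous_intros)
  then show "continuous_on UNIV k" by (simp add: g)
  show "\<exists>g'\<in>{g s |g. smooth2_on UNIV g}. \<forall>x\<in>UNIV. (k has_vector_derivative g' x) (at x)"
    using smooth2_elim(3)[OF g(2)] g(1) by fastforce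
qed

lemma smooth2_reparam:
  fixes f :: "real \<Rightarrow> real \<Rightarrow> 'a::real_normed_algebra_1"
  assumes "smooth2_on UNIV f"
  shows "smooth2_on UNIV (\<lambda>s t. f (a + b * s) t)"
proof -
  let ?F = "{\<lambda>s t. f (a + b * s) t |f::real \<Rightarrow> real \<Rightarrow> 'a. smooth2_on UNIV f}"
  show ?thesis
  proof (rule smooth2_coinduct[of _ ?F], goal_cases)
    case 1 then show ?case using assms by blast
  next
    case (2 g)
    then obtain f where f: "g = (\<lambda>s t. f (a + b * s) t)" "smooth2_on UNIV f" by blast
    have "continuous_on UNIV (\<lambda>p. (\<lambda>(s,t). f s t) (a + b * fst p, snd p))"
      by (rule continuous_on_compose2[OF smooth2_elim(1)[OF f(2)]]) (auto intro!: continuous_intros)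
    then show ?case by (simp add: f split_beta)
  next
    case (3 g)
    then obtain f where f: "g = (\<lambda>s t. f (a + b * s) t)" "smooth2_on UNIV f" by blast
    obtain f1 where f1: "smooth2_on UNIV f1" "\<And>s t. ((\<lambda>s. f s t) has_vector_derivative f1 s t) (at s)"
      using smooth2_elim(2)[OF f(2)] by blast
    have "((\<lambda>s. a + b * s) has_vector_derivative b) (at s)" for s
      by (auto intro!: derivative_eq_intros)
    then have "((\<lambda>s. g s t) has_vector_derivative of_real b * f1 (a + b * s) t) (at s)" for s t
      using vector_diff_chain_at[OF _ f1(2), of "\<lambda>s. a + b * s" b s t] f(1)
      by (simp add: o_def scaleR_conv_of_real)
    moreover have "(\<lambda>s t. of_real b * f1 (a + b * s) t) \<in> ?F"
      by (intro CollectI exI[of _ "\<lambda>s t. of_real b * f1 s t"] conjI refl smooth2_mult smooth2_const f1)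
    ultimately show ?case by (intro bexI) auto
  next
    case (4 g)
    then obtain f where f: "g = (\<lambda>s t. f (a + b * s) t)" "smooth2_on UNIV f" by blast
    obtain f2 where "smooth2_on UNIV f2" "\<And>s t. ((\<lambda>t. f s t) has_vector_derivative f2 s t) (at t)"
      using smooth2_elim(3)[OF f(2)] by blast
    then show ?case unfolding f
      by (intro bexI[of _ "\<lambda>s t. f2 (a + b * s) t"] CollectI exI[of _ f2] conjI refl allI)
  qed
qed

text \<open>Lets an endpoint value such as \<open>primitive tangent s (2*pi)\<close> count as a
  smooth function of both variables; the zero function joins the family as the partial derivative in
  \<open>t\<close>.\<close>

lemma smooth2_freeze:
  assumes "smooth2_on UNIV f" shows "smooth2_on UNIV (\<lambda>s t. f s z)"
proof (rule smooth2_coinduct[of _ "{\<lambda>s t. f s z |f. smooth2_on UNIV f} \<union> {\<lambda>s t. 0}"], goal_cases)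
  case 1 show ?case using assms by blast
next
  case (2 g)
  then consider f where "g = (\<lambda>s t. f s z)" "smooth2_on UNIV f" | "g = (\<lambda>s t. 0)" by blast
  then show ?case
  proof cases
    case 1
    have "continuous_on UNIV (\<lambda>p. (\<lambda>(s,t). f s t) (fst p, z))"
      by (rule continuous_on_compose2[OF smooth2_elim(1)[OF 1(2)]]) (auto intro!: continuous_intros)
    then show ?thesis by (simp add: 1(1) split_beta)
  qed simp
next
  case (3 g)
  then consider f where "g = (\<lambda>s t. f s z)" "smooth2_on UNIV f" | "g = (\<lambda>s t. 0)" by blast
  then show ?case
  proof cases
    case 1
    obtain f' where "smooth2_on UNIV f'" "\<And>s t. ((\<lambda>s. f s t) has_vector_derivative f' s t) (at s)"
      using smooth2_elim(2)[OF 1(2)] by blast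
    then show ?thesis unfolding 1(1)
      by (intro bexI[of _ "\<lambda>s t. f' s z"] UnI1 CollectI exI[of _ f'] conjI refl allI)
  qed auto
next
  case (4 g)
  then show ?case by (intro bexI[of _ "\<lambda>s t. 0"]) auto
qed

text \<open>By uniqueness of derivatives an explicit formula, even one with a floor such as
  \<open>angle_s\<close>, is smooth once it is known to be a partial derivative of a smooth
  function.\<close>

lemma smooth2_partial_fst:
  assumes f: "smooth2_on UNIV f" and d: "\<And>s t. ((\<lambda>s. f s t) has_vector_derivative f' s t) (at s)"
  shows "smooth2_on UNIV f'"
proof -
  obtain f1 where f1: "smooth2_on UNIV f1" "\<And>s t. ((\<lambda>s. f s t) has_vector_derivative f1 s t) (at s)"
    using smooth2_elim(2)[OF f] by blast
  have "f' s t = f1 s t" for s t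
    by (rule vector_derivative_unique_at[OF d f1(2)])
  then have "f' = f1" by (intro ext)
  with f1(1) show ?thesis by simp
qed

lemma smooth2_partial_snd:
  assumes f: "smooth2_on UNIV f" and d: "\<And>s t. (f s has_vector_derivative f' s t) (at t)"
  shows "smooth2_on UNIV f'"
proof -
  obtain f1 where f1: "smooth2_on UNIV f1" "\<And>s t. ((\<lambda>t. f s t) has_vector_derivative f1 s t) (at t)"
    using smooth2_elim(3)[OF f] by blast
  have "f' s t = f1 s t" for s t
    by (rule vector_derivative_unique_at[OF d f1(2)])
  then have "f' = f1" by (intro ext)
  with f1(1) show ?thesis by simp
qed

section \<open>Primitives\<close>

text \<open>The integral from 0 to \<open>t\<close> after a substitution: the domain is fixed, so
  derivatives pass under the integral sign, and \<open>t\<close> may be negative.\<close>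

definition primitive :: "(real \<Rightarrow> real \<Rightarrow> 'a::{real_normed_algebra_1,banach}) \<Rightarrow> real \<Rightarrow> real \<Rightarrow> 'a" where
  "primitive g s t = t *\<^sub>R integral {0..1} (\<lambda>u. g s (u * t))"

lemma primitive_0 [simp]: "primitive g s 0 = 0"
  by (simp add: primitive_def)

lemma continuous_on_slice:
  assumes "continuous_on UNIV (\<lambda>(s,t). g s t)"
  shows "continuous_on A (g s)"
proof -
  have "continuous_on A (\<lambda>t. (\<lambda>(s,t). g s t) (s,t))"
    by (rule continuous_on_compose2[OF assms]) (auto intro!: continuous_intros)
  then show ?thesis by simp
qed

lemma primitive_has_vector_derivative:
  fixes g :: "real \<Rightarrow> real \<Rightarrow> 'a::{real_normed_algebra_1,banach}"
  assumes g: "smooth2_on UNIV g"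
  shows "(primitive g s has_vector_derivative g s t) (at t)"
proof -
  obtain g2 where g2: "smooth2_on UNIV g2" "\<And>s t. ((\<lambda>t. g s t) has_vector_derivative g2 s t) (at t)"
    using smooth2_elim(3)[OF g] by blast
  have scale: "((\<lambda>t. u * t) has_vector_derivative u) (at t)" "((\<lambda>t. t * u) has_vector_derivative u) (at t)" for u t :: real
    by (auto intro!: derivative_eq_intros)
  have d: "((\<lambda>t. g s (u * t)) has_vector_derivative u *\<^sub>R g2 s (u * t)) (at t)" for u t
    using vector_diff_chain_at[OF scale(1) g2(2)] by (simp add: o_def)
  have cont: "continuous_on A (\<lambda>u. g s (u * t))" "continuous_on A (\<lambda>u. u *\<^sub>R g2 s (u * t))" for A t
    by (rule continuous_on_compose2[OF continuous_on_slice[OF smooth2_elim(1)[OF g], of UNIV]]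
        | rule continuous_on_compose2[OF continuous_on_slice[OF smooth2_elim(1)[OF g2(1)], of UNIV]]
        | auto intro!: continuous_intros)+
  have "((\<lambda>t. integral (cbox 0 1) (\<lambda>u. g s (u * t))) has_vector_derivative
      integral (cbox 0 1) (\<lambda>u. u *\<^sub>R g2 s (u * t))) (at t within UNIV)"
  proof (rule leibniz_rule_vector_derivative)
    show "(\<lambda>u. g s (u * t)) integrable_on cbox 0 1" for t
      by (rule integrable_continuous[OF cont(1)])
    have "continuous_on (UNIV \<times> cbox 0 1) (\<lambda>p. g2 s (snd p * fst p))"
      by (rule continuous_on_compose2[OF continuous_on_slice[OF smooth2_elim(1)[OF g2(1)], of UNIV]])
        (auto intro!: continuous_intros)
    then show "continuous_on (UNIV \<times> cbox 0 1) (\<lambda>(t, u). u *\<^sub>R g2 s (u * t))"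
      by (auto simp: split_beta intro!: continuous_intros)
  qed (use d in auto)
  then have "(primitive g s has_vector_derivative
      t *\<^sub>R integral {0..1} (\<lambda>u. u *\<^sub>R g2 s (u * t)) + integral {0..1} (\<lambda>u. g s (u * t))) (at t)"
    unfolding primitive_def by (auto intro!: derivative_eq_intros)
  moreover have "t *\<^sub>R integral {0..1} (\<lambda>u. u *\<^sub>R g2 s (u * t)) + integral {0..1} (\<lambda>u. g s (u * t)) = g s t"
  proof -
    \<comment> \<open>The two summands together integrate the \<open>u\<close>-derivative of u times
      \<open>g s (u * t)\<close>, whose boundary values are 0 and \<open>g s t\<close>.\<close>
    have du: "((\<lambda>u. u *\<^sub>R g s (u * t)) has_vector_derivative
        (u *\<^sub>R (t *\<^sub>R g2 s (u * t)) + 1 *\<^sub>R g s (u * t))) (at u within {0..1})" for u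
    proof (rule has_vector_derivative_at_within, rule has_vector_derivative_scaleR[OF DERIV_ident])
      show "((\<lambda>u. g s (u * t)) has_vector_derivative t *\<^sub>R g2 s (u * t)) (at u)"
        using vector_diff_chain_at[OF scale(2) g2(2)] by (simp add: o_def)
    qed
    have "((\<lambda>u. u *\<^sub>R (t *\<^sub>R g2 s (u * t)) + 1 *\<^sub>R g s (u * t)) has_integral
        (1 *\<^sub>R g s (1 * t) - 0 *\<^sub>R g s (0 * t))) {0..1}"
      by (rule fundamental_theorem_of_calculus) (use du in auto)
    moreover have "(\<lambda>u. u *\<^sub>R (t *\<^sub>R g2 s (u * t)) + 1 *\<^sub>R g s (u * t))
        = (\<lambda>u. t *\<^sub>R (u *\<^sub>R g2 s (u * t)) + g s (u * t))"
      by (simp add: fun_eq_iff mult.commute)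
    ultimately have "integral {0..1} (\<lambda>u. t *\<^sub>R (u *\<^sub>R g2 s (u * t)) + g s (u * t)) = g s t"
      by (simp add: integral_unique)
    moreover have "(\<lambda>u. t *\<^sub>R (u *\<^sub>R g2 s (u * t))) integrable_on {0..1}"
      "(\<lambda>u. g s (u * t)) integrable_on {0..1}"
      by (intro integrable_cmul integrable_continuous_real cont)+
    ultimately show ?thesis by (simp only: integral_add integral_cmul)
  qed
  ultimately show ?thesis by simp
qed

lemma primitive_integral:
  assumes "smooth2_on UNIV g" "0 \<le> t"
  shows "(g s has_integral primitive g s t) {0..t}"
  using fundamental_theorem_of_calculus[OF assms(2), of "primitive g s" "g s"]
    has_vector_derivative_at_within[OF primitive_has_vector_derivative[OF assms(1)]] by simp

lemma primitive_has_vector_derivative_fst: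
  fixes g :: "real \<Rightarrow> real \<Rightarrow> 'a::{real_normed_algebra_1,banach}"
  assumes g: "smooth2_on UNIV g" and g1: "smooth2_on UNIV g1"
    and d: "\<And>s t. ((\<lambda>s. g s t) has_vector_derivative g1 s t) (at s)"
  shows "((\<lambda>s. primitive g s t) has_vector_derivative primitive g1 s t) (at s)"
proof -
  have "((\<lambda>s. integral (cbox 0 1) (\<lambda>u. g s (u * t))) has_vector_derivative
      integral (cbox 0 1) (\<lambda>u. g1 s (u * t))) (at s within UNIV)"
  proof (rule leibniz_rule_vector_derivative)
    show "(\<lambda>u. g s (u * t)) integrable_on cbox 0 1" for s
      by (rule integrable_continuous, rule continuous_on_compose2[OF continuous_on_slice[OF smooth2_elim(1)[OF g], of UNIV]])
        (auto intro!: continuous_intros)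
    have "continuous_on (UNIV \<times> cbox 0 1) (\<lambda>p. (\<lambda>(s,t). g1 s t) (fst p, snd p * t))"
      by (rule continuous_on_compose2[OF smooth2_elim(1)[OF g1]]) (auto intro!: continuous_intros)
    then show "continuous_on (UNIV \<times> cbox 0 1) (\<lambda>(s, u). g1 s (u * t))"
      by (simp add: split_beta)
  qed (use d in auto)
  then show ?thesis unfolding primitive_def by (auto intro!: derivative_eq_intros)
qed

text \<open>Primitives and smooth functions together form a closed family: the
  \<open>s\<close>-partial of a primitive is the primitive of the \<open>s\<close>-partial, and its
  \<open>t\<close>-partial is the integrand.\<close>

lemma smooth2_primitive [smooth2_intros]:
  fixes g :: "real \<Rightarrow> real \<Rightarrow> 'a::{real_normed_algebra_1,banach}"
  assumes "smooth2_on UNIV g"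
  shows "smooth2_on UNIV (primitive g)"
proof (rule smooth2_coinduct[of _ "primitive ` {g. smooth2_on UNIV g} \<union> {g. smooth2_on UNIV g}"], goal_cases)
  case 1 then show ?case using assms by blast
next
  case (2 f)
  then consider g where "f = primitive g" "smooth2_on UNIV g" | "smooth2_on UNIV f" by blast
  then show ?case
  proof cases
    case 1
    have "continuous_on (UNIV \<times> cbox 0 1) (\<lambda>p. (\<lambda>(s,t). g s t) (fst (fst p), snd p * snd (fst p)))"
      by (rule continuous_on_compose2[OF smooth2_elim(1)[OF 1(2)]]) (auto intro!: continuous_intros)
    then have "continuous_on UNIV (\<lambda>p. integral (cbox 0 1) (\<lambda>u. g (fst p) (u * snd p)))"
      by (intro integral_continuous_on_param) (simp add: split_beta)
    then show ?thesis
      unfolding 1(1) primitive_def by (auto simp: split_beta intro!: continuous_intros)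
  qed (rule smooth2_elim(1))
next
  case (3 f)
  then consider g where "f = primitive g" "smooth2_on UNIV g" | "smooth2_on UNIV f" by blast
  then show ?case
  proof cases
    case 1
    obtain g1 where g1: "smooth2_on UNIV g1" "\<And>s t. ((\<lambda>s. g s t) has_vector_derivative g1 s t) (at s)"
      using smooth2_elim(2)[OF 1(2)] by blast
    show ?thesis unfolding 1(1)
      by (intro bexI[of _ "primitive g1"] UnI1 imageI CollectI allI g1 1(2) primitive_has_vector_derivative_fst)
  next
    case 2 then show ?thesis using smooth2_elim(2)[OF 2] by blast
  qed
next
  case (4 f)
  then consider g where "f = primitive g" "smooth2_on UNIV g" | "smooth2_on UNIV f" by blast
  then show ?case
  proof cases
    case 1
    show ?thesis unfolding 1(1)
      by (intro bexI[of _ g] UnI2 CollectI allI 1(2) primitive_has_vector_derivative)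
  next
    case 2 then show ?thesis using smooth2_elim(3)[OF 2] by blast
  qed
qed

section \<open>A smooth step and smooth interpolation\<close>

text \<open>The functions p(1/x) exp(-1/x), extended by 0, form a class closed under
  differentiation; this is what makes exp(-1/x) smooth at 0.\<close>

definition flat_exp :: "real poly \<Rightarrow> real \<Rightarrow> real" where
  "flat_exp p x = (if x \<le> 0 then 0 else poly p (1 / x) * exp (- (1 / x)))"

lemma poly_times_exp_neg_tendsto_0: "((\<lambda>y::real. poly p y * exp (- y)) \<longlongrightarrow> 0) at_top"
proof -
  have "((\<lambda>y. \<Sum>i\<le>degree p. coeff p i * (y ^ i / exp y)) \<longlongrightarrow> (\<Sum>i\<le>degree p. coeff p i * 0)) at_top"
    by (intro tendsto_intros tendsto_power_div_exp_0)
  then show ?thesis by (simp add: poly_altdef exp_minus field_simps sum_distrib_left sum_divide_distrib)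
qed

text \<open>With y = 1/x the derivative in x is -y^2 times the derivative in y, whence the
  polynomial y^2 (p - p').\<close>

lemma flat_exp_has_vector_derivative:
  "(flat_exp p has_vector_derivative flat_exp ([:0,0,1:] * (p - pderiv p)) x) (at x)"
proof -
  let ?q = "[:0,0,1:] * (p - pderiv p)"
  consider "x < 0" | "x > 0" | "x = 0" by linarith
  then show ?thesis
  proof cases
    case 1
    show ?thesis
      by (rule has_vector_derivative_transform_within_open[of "\<lambda>x. 0" _ _ "{..<0}"])
        (use 1 in \<open>auto simp: flat_exp_def\<close>)
  next
    case 2
    have "((\<lambda>x. poly p (1 / x) * exp (- (1 / x))) has_field_derivative flat_exp ?q x) (at x)"
      using 2 by (auto simp: flat_exp_def field_simps power2_eq_square intro!: derivative_eq_intros poly_DERIV[THEN DERIV_chain2])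
    then show ?thesis
      unfolding has_real_derivative_iff_has_vector_derivative
      by (rule has_vector_derivative_transform_within_open[where S="{0<..}"])
        (use 2 in \<open>auto simp: flat_exp_def\<close>)
  next
    case 3
    \<comment> \<open>The difference quotient at 0 contributes one more factor y = 1/h, which is
      absorbed into the polynomial.\<close>
    have "((\<lambda>y. poly [:0,1:] y * poly p y * exp (- y)) \<longlongrightarrow> 0) at_top"
      using poly_times_exp_neg_tendsto_0[of "[:0,1:] * p"] by (simp only: poly_mult)
    then have "((\<lambda>h. 1 / h * poly p (1 / h) * exp (- (1 / h))) \<longlongrightarrow> 0) (at_right 0)"
      by (simp add: filterlim_at_top_to_right inverse_eq_divide)
    then have "((\<lambda>h. flat_exp p h / h) \<longlongrightarrow> 0) (at_right 0)"
      by (rule Lim_transform_eventually)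
        (auto simp: flat_exp_def eventually_at_filter)
    moreover have "((\<lambda>h. flat_exp p h / h) \<longlongrightarrow> 0) (at_left 0)"
      by (rule Lim_transform_eventually[OF tendsto_const])
        (auto simp: flat_exp_def eventually_at_filter)
    ultimately have "((\<lambda>h. flat_exp p h / h) \<longlongrightarrow> 0) (at 0)"
      by (simp add: filterlim_split_at)
    then show ?thesis
      using 3 by (simp add: has_real_derivative_iff_has_vector_derivative[symmetric]
          has_field_derivative_iff flat_exp_def[of _ 0])
  qed
qed

lemma smooth1_flat_exp: "smooth1_on UNIV (flat_exp p)"
  unfolding smooth1_on_def
proof (intro exI[of _ "range flat_exp"] conjI ballI)
  fix g assume "g \<in> range flat_exp"
  then obtain p where g: "g = flat_exp p" by blast
  show "continuous_on UNIV g"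
    unfolding g by (intro continuous_at_imp_continuous_on ballI
        has_vector_derivative_continuous[OF flat_exp_has_vector_derivative])
  show "\<exists>g'\<in>range flat_exp. \<forall>x\<in>UNIV. (g has_vector_derivative g' x) (at x)"
    using flat_exp_has_vector_derivative unfolding g by blast
qed simp

section \<open>A normalised smooth step from 0 to 1, constant outside the unit interval\<close>

definition bump :: "real \<Rightarrow> real" where
  "bump x = flat_exp 1 x * flat_exp 1 (1 - x)"

lemma smooth2_bump: "smooth2_on UNIV (\<lambda>s t. bump t)"
  unfolding bump_def by (intro smooth2_intros smooth2_compose[OF smooth1_flat_exp])

lemma bump_bounds: "0 \<le> bump x" "bump x \<le> 1"
  by (auto simp: bump_def flat_exp_def intro: mult_le_one)

lemma bump_eq_0: "x \<le> 0 \<or> 1 \<le> x \<Longrightarrow> bump x = 0"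
  by (auto simp: bump_def flat_exp_def)

lemma bump_pos: "0 < x \<Longrightarrow> x < 1 \<Longrightarrow> 0 < bump x"
  by (auto simp: bump_def flat_exp_def)

definition bump_mass :: real where "bump_mass = primitive (\<lambda>s. bump) 0 1"

lemma primitive_bump_deriv: "(primitive (\<lambda>s. bump) 0 has_field_derivative bump x) (at x)"
  using primitive_has_vector_derivative[OF smooth2_bump]
  by (simp add: has_real_derivative_iff_has_vector_derivative)

lemma bump_mass_pos: "bump_mass > 0"
proof -
  have "primitive (\<lambda>s. bump) 0 0 < primitive (\<lambda>s. bump) 0 1"
  proof (rule DERIV_pos_imp_increasing_open[where f="primitive (\<lambda>s. bump) 0"])
    show "continuous_on {0..1} (primitive (\<lambda>s. bump) 0)"
      by (rule continuous_at_imp_continuous_on) (blast intro: DERIV_isCont primitive_bump_deriv)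
  qed (use primitive_bump_deriv bump_pos in auto)
  then show ?thesis by (simp add: bump_mass_def)
qed

definition smooth_step :: "real \<Rightarrow> real" where
  "smooth_step x = primitive (\<lambda>s. bump) 0 x / bump_mass"

definition smooth_step' :: "real \<Rightarrow> real" where
  "smooth_step' x = bump x / bump_mass"

lemma smooth_step_deriv: "(smooth_step has_field_derivative smooth_step' x) (at x)"
  unfolding smooth_step_def smooth_step'_def by (intro DERIV_cdivide primitive_bump_deriv)

lemma smooth1_smooth_step: "smooth1_on UNIV smooth_step"
proof -
  have "smooth2_on UNIV (\<lambda>s t. primitive (\<lambda>s. bump) s t * (1 / bump_mass))"
    by (intro smooth2_intros smooth2_bump)
  from smooth2_imp_smooth1[OF this, of 0] show ?thesis by (simp add: smooth_step_def[abs_def])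
qed

lemma smooth_step'_bounds: "0 \<le> smooth_step' x" "smooth_step' x \<le> 1 / bump_mass"
  using bump_bounds bump_mass_pos by (auto simp: smooth_step'_def divide_right_mono)

lemma smooth_step'_eq_0: "x \<le> 0 \<or> 1 \<le> x \<Longrightarrow> smooth_step' x = 0"
  by (simp add: smooth_step'_def bump_eq_0)

lemma smooth_step_mono: "x \<le> y \<Longrightarrow> smooth_step x \<le> smooth_step y"
  using smooth_step_deriv smooth_step'_bounds by (meson DERIV_nonneg_imp_nondecreasing)

lemma smooth_step_eq_0: "x \<le> 0 \<Longrightarrow> smooth_step x = 0"
proof -
  assume "x \<le> 0"
  then have "integral {0..1} (\<lambda>u. bump (u * x)) = integral {0..1} (\<lambda>u::real. 0)"
    by (intro integral_cong bump_eq_0) (auto simp: mult_le_0_iff)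
  then show ?thesis by (simp add: smooth_step_def primitive_def)
qed

lemma smooth_step_eq_1: "1 \<le> x \<Longrightarrow> smooth_step x = 1"
proof -
  assume "1 \<le> x"
  moreover have "smooth_step 1 = 1" using bump_mass_pos by (simp add: smooth_step_def bump_mass_def)
  moreover have "smooth_step x \<le> smooth_step 1"
    using \<open>1 \<le> x\<close> smooth_step_deriv smooth_step'_eq_0
    by (intro DERIV_nonpos_imp_nonincreasing[of 1 x]) (metis order_refl)+
  ultimately show ?thesis using smooth_step_mono[of 1 x] by simp
qed

lemma smooth_step_bounds: "0 \<le> smooth_step x" "smooth_step x \<le> 1"
  using smooth_step_mono[of 0 x] smooth_step_mono[of x 0] smooth_step_mono[of x 1]
    smooth_step_eq_0[of x] smooth_step_eq_0[of 0] smooth_step_eq_1[of x] smooth_step_eq_1[of 1]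
  by linarith+

text \<open>Used in two directions: in the curve parameter between nodal values of \<beta>, and in
  the level parameter between successive approximations.\<close>

definition interp :: "(int \<Rightarrow> real) \<Rightarrow> real \<Rightarrow> real" where
  "interp a y = a \<lfloor>y\<rfloor> + smooth_step (y - \<lfloor>y\<rfloor>) * (a (\<lfloor>y\<rfloor> + 1) - a \<lfloor>y\<rfloor>)"

text \<open>The flat ends of the step make this formula, valid across the node \<open>k\<close>, smooth.\<close>
lemma interp_local:
  fixes y :: real
  assumes "of_int k - 1 < y" "y < of_int k + 1"
  shows "interp a y = a (k - 1) + smooth_step (y - k + 1) * (a k - a (k - 1))
    + smooth_step (y - k) * (a (k + 1) - a k)"
proof (cases "y < k")
  case True
  then have fl: "\<lfloor>y\<rfloor> = k - 1" using assms by (intro floor_unique) auto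
  have e: "y - of_int (k - 1) = y - k + 1" by simp
  have "interp a y = a (k - 1) + smooth_step (y - k + 1) * (a k - a (k - 1))"
    unfolding interp_def fl e by simp
  with True show ?thesis by (simp add: smooth_step_eq_0)
next
  case False
  then have "\<lfloor>y\<rfloor> = k" using assms by (intro floor_unique) auto
  with False show ?thesis by (simp add: interp_def smooth_step_eq_1)
qed

lemma interp_has_field_derivative:
  fixes y :: real
  shows "(interp a has_field_derivative smooth_step' (y - \<lfloor>y\<rfloor>) * (a (\<lfloor>y\<rfloor> + 1) - a \<lfloor>y\<rfloor>)) (at y)"
proof -
  define k where "k = \<lfloor>y\<rfloor>"
  have k: "of_int k \<le> y" "y < of_int k + 1" by (auto simp: k_def)
  have "((\<lambda>y. a (k - 1) + smooth_step (y - k + 1) * (a k - a (k - 1))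
      + smooth_step (y - k) * (a (k + 1) - a k)) has_field_derivative
    smooth_step' (y - k + 1) * (a k - a (k - 1)) + smooth_step' (y - k) * (a (k + 1) - a k)) (at y)"
    by (auto intro!: derivative_eq_intros smooth_step_deriv[THEN DERIV_chain2])
  \<comment> \<open>Since \<open>y - k + 1\<close> is at least 1, the slope of the left-hand step
    vanishes.\<close>
  then have "((\<lambda>y. a (k - 1) + smooth_step (y - k + 1) * (a k - a (k - 1))
      + smooth_step (y - k) * (a (k + 1) - a k)) has_field_derivative
    smooth_step' (y - k) * (a (k + 1) - a k)) (at y)"
    using k by (simp add: smooth_step'_eq_0)
  then show ?thesis unfolding k_def[symmetric]
    by (rule has_field_derivative_transform_within_open[where S="{of_int k - 1<..<of_int k + 1}"])
      (use k in \<open>auto simp: interp_local\<close>)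
qed

text \<open>The interpolant is a convex combination of the two adjacent values, so it never
  overshoots.\<close>

lemma interp_close:
  fixes y :: real
  assumes "\<bar>a \<lfloor>y\<rfloor> - z\<bar> \<le> r" "\<bar>a (\<lfloor>y\<rfloor> + 1) - z\<bar> \<le> r"
  shows "\<bar>interp a y - z\<bar> \<le> r"
proof -
  let ?w = "smooth_step (y - \<lfloor>y\<rfloor>)"
  have "interp a y - z = (1 - ?w) * (a \<lfloor>y\<rfloor> - z) + ?w * (a (\<lfloor>y\<rfloor> + 1) - z)"
    by (simp add: interp_def algebra_simps)
  also have "\<bar>\<dots>\<bar> \<le> (1 - ?w) * r + ?w * r"
    using assms smooth_step_bounds[of "y - \<lfloor>y\<rfloor>"]
    by (intro order.trans[OF abs_triangle_ineq] add_mono) (auto simp: abs_mult intro!: mult_left_mono)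
  finally show ?thesis by (simp add: algebra_simps)
qed

lemma interp_periodic:
  fixes y :: real
  assumes "\<And>k. a (k + N) = a k"
  shows "interp a (y + of_int N) = interp a y"
  using assms[of "\<lfloor>y\<rfloor>"] assms[of "\<lfloor>y\<rfloor> + 1"] by (simp add: interp_def algebra_simps)

lemma smooth2_interp:
  assumes a: "\<And>k. smooth2_on UNIV (a k)" and h: "smooth2_on UNIV h"
  shows "smooth2_on UNIV (\<lambda>s t. interp (\<lambda>k. a k s t) (h s t))"
proof (rule smooth2_local)
  fix s t
  define k where "k = \<lfloor>h s t\<rfloor>"
  have k: "of_int k \<le> h s t" "h s t < of_int k + 1" by (auto simp: k_def)
  have "open ((\<lambda>(s,t). h s t) -` {of_int k - 1<..<of_int k + 1})"
    by (rule continuous_open_vimage[OF _ smooth2_elim(1)[OF h, THEN continuous_on_eq_continuous_at[OF open_UNIV, THEN iffD1], rule_format]]) auto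
  moreover have "smooth2_on UNIV (\<lambda>s t. a (k - 1) s t + smooth_step (h s t - k + 1) * (a k s t - a (k - 1) s t)
    + smooth_step (h s t - k) * (a (k + 1) s t - a k s t))"
    by (intro smooth2_intros a h smooth2_compose[OF smooth1_smooth_step])
  ultimately show "\<exists>U g. open U \<and> (s, t) \<in> U \<and> smooth2_on UNIV g \<and>
      (\<forall>(s', t')\<in>U. interp (\<lambda>k. a k s' t') (h s' t') = g s' t')"
    using k by (intro exI conjI) (auto simp: interp_local)
qed

section \<open>Bounded variation and integrals\<close>

text \<open>Here \<open>g\<close> is the variation function, the supremum of the variation sums over
  lists in \<open>{a..x}\<close>. Its increments over adjacent cells telescope, which is what the
  later estimates exploit.\<close>

lemma bv_on_dominated:
  assumes "bv_on f a b"
  obtains g where "\<And>x y. a \<le> x \<Longrightarrow> x \<le> y \<Longrightarrow> y \<le> b \<Longrightarrow> \<bar>f x - f y\<bar> \<le> g y - g x"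
proof -
  define sv where "sv xs = (\<Sum>i < length xs - 1. \<bar>f (xs ! Suc i) - f (xs ! i)\<bar>)" for xs
  obtain M where M: "\<And>xs. sorted xs \<Longrightarrow> set xs \<subseteq> {a..b} \<Longrightarrow> sv xs \<le> M"
    using assms unfolding bv_on_def sv_def by blast
  define S where "S x = {sv xs |xs. sorted xs \<and> set xs \<subseteq> {a..x}}" for x
  have snoc: "sv xs \<le> sv (xs @ [x])" for xs x
  proof -
    have "sv xs = (\<Sum>i < length xs - 1. \<bar>f ((xs @ [x]) ! Suc i) - f ((xs @ [x]) ! i)\<bar>)"
      unfolding sv_def by (intro sum.cong) (auto simp: nth_append)
    also have "\<dots> \<le> sv (xs @ [x])"
      unfolding sv_def by (intro sum_mono2) auto
    finally show ?thesis .
  qed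
  have snoc2: "sv (xs @ [x, y]) = sv (xs @ [x]) + \<bar>f y - f x\<bar>" for xs x y
  proof -
    have "sv (xs @ [x, y]) = (\<Sum>i < Suc (length xs). \<bar>f ((xs @ [x, y]) ! Suc i) - f ((xs @ [x, y]) ! i)\<bar>)"
      by (simp add: sv_def)
    also have "\<dots> = (\<Sum>i < length xs. \<bar>f ((xs @ [x, y]) ! Suc i) - f ((xs @ [x, y]) ! i)\<bar>) + \<bar>f y - f x\<bar>"
      by (simp add: nth_append)
    also have "(\<Sum>i < length xs. \<bar>f ((xs @ [x, y]) ! Suc i) - f ((xs @ [x, y]) ! i)\<bar>) = sv (xs @ [x])"
      unfolding sv_def by (intro sum.cong) (auto simp: nth_append)
    finally show ?thesis .
  qed
  show ?thesis
  proof
    fix x y assume xy: "a \<le> x" "x \<le> y" "y \<le> b"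
    \<comment> \<open>Any list in \<open>{a..x}\<close> can be prolonged by \<open>x\<close> and
      \<open>y\<close>: the first addition does not lower its sum, the second adds the increment of
      \<open>f\<close>.\<close>
    have "Sup (S x) \<le> Sup (S y) - \<bar>f x - f y\<bar>"
    proof (rule cSup_least)
      have "sv [] \<in> S x" unfolding S_def by (intro CollectI exI[of _ "[]"]) auto
      then show "S x \<noteq> {}" by blast
      fix v assume "v \<in> S x"
      then obtain xs where xs: "v = sv xs" "sorted xs" "set xs \<subseteq> {a..x}" unfolding S_def by blast
      have "sv (xs @ [x, y]) \<in> S y"
        unfolding S_def using xs xy by (intro CollectI exI[of _ "xs @ [x, y]"]) (auto simp: sorted_append)
      moreover have "bdd_above (S y)"
        unfolding bdd_above_def S_def using M xy by (intro exI[of _ M]) fastforce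
      ultimately have "sv (xs @ [x, y]) \<le> Sup (S y)" by (intro cSup_upper)
      then show "v \<le> Sup (S y) - \<bar>f x - f y\<bar>" using snoc[of xs x] snoc2[of xs x y] xs by simp
    qed
    then show "\<bar>f x - f y\<bar> \<le> Sup (S y) - Sup (S x)" by simp
  qed
qed

text \<open>\<open>(P (x + h) - P x) / h\<close> is an antiderivative of the difference quotient of
  \<open>c\<close>. Its boundary values are difference quotients of \<open>P\<close>, which tend to
  values of \<open>c\<close> as \<open>h\<close> shrinks.\<close>

lemma has_integral_right_quotient:
  fixes c :: "real \<Rightarrow> 'a::euclidean_space"
  assumes P: "\<And>x. x \<in> {a..b + h} \<Longrightarrow> (P has_vector_derivative c x) (at x)" and "a \<le> b" "h > 0"
  shows "((\<lambda>x. (c (x + h) - c x) /\<^sub>R h) has_integral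
    ((P (b + h) - P b) /\<^sub>R h - (P (a + h) - P a) /\<^sub>R h)) {a..b}"
proof -
  have sh: "((\<lambda>x. x + h) has_vector_derivative 1) (at x)" for x
    by (auto intro!: derivative_eq_intros)
  have "((\<lambda>x. P (x + h)) has_vector_derivative c (x + h)) (at x)" if "x \<in> {a..b}" for x
    using vector_diff_chain_at[OF sh P[of "x + h"]] that assms by (simp add: o_def)
  then have "((\<lambda>x. (P (x + h) - P x) /\<^sub>R h) has_vector_derivative (c (x + h) - c x) /\<^sub>R h) (at x within {a..b})"
    if "x \<in> {a..b}" for x
    using that assms by (intro has_vector_derivative_at_within[OF bounded_linear.has_vector_derivative[OF
          bounded_linear_scaleR_right]] has_vector_derivative_diff P) auto
  then have "((\<lambda>x. (c (x + h) - c x) /\<^sub>R h) has_integral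
      ((P (b + h) - P b) /\<^sub>R h - (P (a + h) - P a) /\<^sub>R h)) {a..b}"
    by (rule fundamental_theorem_of_calculus[OF \<open>a \<le> b\<close>])
  then show ?thesis .
qed

text \<open>The integrals of the difference quotients converge by dominated convergence on one side,
  and to \<open>c b - c a\<close> by the fundamental theorem for an antiderivative of \<open>c\<close> on the other.\<close>
lemma lipschitz_has_integral_derivative:
  fixes c c' :: "real \<Rightarrow> 'a::euclidean_space"
  assumes lip: "C-lipschitz_on UNIV c"
    and d: "AE x in lborel. (c has_vector_derivative c' x) (at x)" and "a \<le> b"
  shows "(c' has_integral (c b - c a)) {a..b}"
proof -
  obtain N where N: "{x \<in> space lborel. \<not> (c has_vector_derivative c' x) (at x)} \<subseteq> N"
    "emeasure lborel N = 0" "N \<in> sets lborel"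
    by (rule AE_E[OF d])
  then have neg: "negligible N"
    by (simp add: negligible_iff_null_sets null_setsI null_sets_completionI)
  define h where "h n = 1 / real (Suc n)" for n
  have h: "h n > 0" "h n \<le> 1" for n by (auto simp: h_def)
  have h0: "h \<longlonglongrightarrow> 0" unfolding h_def by (rule LIMSEQ_Suc[OF lim_1_over_n])
  have cont: "continuous_on A c" for A
    using lipschitz_on_continuous_on[OF lip] continuous_on_subset by blast
  \<comment> \<open>The interval is enlarged so that \<open>P\<close> has two-sided derivatives on
    all of \<open>{a..b + 1}\<close>, where the shifts by \<open>h n\<close> take place.\<close>
  obtain P where P0: "\<And>x. x \<in> {a - 1..b + 2} \<Longrightarrow> (P has_vector_derivative c x) (at x within {a - 1..b + 2})"
    using antiderivative_continuous[OF cont, of "a - 1" "b + 2"] by metis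
  have P: "(P has_vector_derivative c x) (at x)" if "x \<in> {a..b + 1}" for x
  proof -
    have "x \<in> interior {a - 1..b + 2}" using that by simp
    from at_within_interior[OF this] P0[of x] that show ?thesis by simp
  qed
  define q where "q n x = (c (x + h n) - c x) /\<^sub>R h n" for n x
  define R where "R n x = (P (x + h n) - P x) /\<^sub>R h n" for n x
  have quot: "(\<lambda>n. (f (x + h n) - f x) /\<^sub>R h n) \<longlonglongrightarrow> D" if "(f has_vector_derivative D) (at x)"
    for f :: "real \<Rightarrow> 'a" and x D
  proof -
    have "((\<lambda>h. norm (f (x + h) - f x - h *\<^sub>R D) / norm h) \<longlongrightarrow> 0) (at 0)"
      using that by (simp add: has_vector_derivative_def has_derivative_at)
    moreover have "filterlim h (at 0) sequentially"
      using h0 less_imp_neq[OF h(1)] by (auto simp: filterlim_at dest: sym)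
    ultimately have "(\<lambda>n. norm (f (x + h n) - f x - h n *\<^sub>R D) / norm (h n)) \<longlonglongrightarrow> 0"
      by (rule filterlim_compose)
    moreover have "norm (f (x + h n) - f x - h n *\<^sub>R D) / norm (h n) = norm ((f (x + h n) - f x) /\<^sub>R h n - D)" for n
    proof -
      have "(f (x + h n) - f x) /\<^sub>R h n - D = (f (x + h n) - f x - h n *\<^sub>R D) /\<^sub>R h n"
        using h(1)[of n] by (simp add: scaleR_diff_right)
      then show ?thesis by (simp add: divide_inverse mult.commute)
    qed
    ultimately have "(\<lambda>n. norm ((f (x + h n) - f x) /\<^sub>R h n - D)) \<longlonglongrightarrow> 0" by simp
    then show ?thesis by (simp add: tendsto_norm_zero_iff LIM_zero_iff)
  qed
  have bound: "norm (q n x) \<le> C" for n x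
  proof -
    have "norm (q n x) = norm (c (x + h n) - c x) / h n"
      using h(1)[of n] by (simp add: q_def divide_inverse mult.commute)
    also have "\<dots> \<le> C"
      using lipschitz_onD[OF lip, of "x + h n" x] h(1)[of n] by (simp add: dist_norm pos_divide_le_eq)
    finally show ?thesis .
  qed
  have "((\<lambda>x. if x \<in> N then 0 else c' x) has_integral (c b - c a)) {a..b}"
  proof (rule has_integral_dominated_convergence)
    show "((\<lambda>x. if x \<in> N then 0 else q n x) has_integral (R n b - R n a)) {a..b}" for n
    proof (rule has_integral_spike[OF neg])
      show "(q n has_integral (R n b - R n a)) {a..b}"
        unfolding q_def[abs_def] R_def using h[of n] \<open>a \<le> b\<close>
        by (intro has_integral_right_quotient) (auto intro!: P)
    qed auto
    show "(\<lambda>x. C) integrable_on {a..b}" by (rule integrable_const_ivl)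
    show "\<forall>x\<in>{a..b}. norm (if x \<in> N then 0 else q n x) \<le> C" for n
      using bound order.trans[OF norm_ge_zero bound] by auto
    show "\<forall>x\<in>{a..b}. (\<lambda>n. if x \<in> N then 0 else q n x) \<longlonglongrightarrow> (if x \<in> N then 0 else c' x)"
      using N(1) quot[of c] unfolding q_def by auto
    show "(\<lambda>n. R n b - R n a) \<longlonglongrightarrow> c b - c a"
      unfolding R_def using \<open>a \<le> b\<close> by (intro tendsto_diff quot P) auto
  qed
  then show ?thesis by (rule has_integral_spike[OF neg, rotated]) auto
qed

text \<open>Converts bounds on half-open cells into an integral bound. With cell variations as the
  \<open>C k\<close>, the sum is the total variation and the cell length supplies the factor
  1/N.\<close>

lemma integral_partition_bound:
  fixes f :: "real \<Rightarrow> 'a::euclidean_space" and N :: nat and C :: "nat \<Rightarrow> real"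
  assumes "N > 0" and f: "f integrable_on {0..2*pi}"
    and C: "\<And>k x. k < N \<Longrightarrow> 2*pi * real k / real N \<le> x \<Longrightarrow> x < 2*pi * real (Suc k) / real N \<Longrightarrow> norm (f x) \<le> C k"
    and \<theta>: "0 \<le> \<theta>" "\<theta> \<le> 2*pi"
  shows "norm (integral {0..\<theta>} f) \<le> 2*pi / N * (\<Sum>k<N. C k)"
proof -
  \<comment> \<open>Cutting \<open>f\<close> off at \<theta> lets the full grid serve for every
    upper limit.\<close>
  define F where "F = (\<lambda>x. if x \<in> {0..\<theta>} then f x else 0)"
  have Fint: "F integrable_on {0..2*pi}"
    unfolding F_def using \<theta> integrable_on_subinterval[OF f, of 0 \<theta>]
    by (subst integrable_restrict_Int) (auto simp: min_def)
  have C0: "0 \<le> C k" if "k < N" for k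
    using C[OF that, of "2*pi * k / N"] \<open>N > 0\<close> order.trans[OF norm_ge_zero] by (auto simp: field_simps)
  define x where "x k = 2*pi * real k / real N" for k
  have xN: "x N = 2*pi" using \<open>N > 0\<close> by (simp add: x_def)
  have xmono: "x k \<le> x m" if "k \<le> m" for k m
    using that by (auto simp: x_def intro!: divide_right_mono)
  have "norm (integral {0..x m} F) \<le> 2*pi / N * (\<Sum>k<m. C k)" if "m \<le> N" for m
    using that
  proof (induction m)
    case 0 then show ?case by (simp add: x_def)
  next
    case (Suc m)
    have sub: "{0..x (Suc m)} \<subseteq> {0..2*pi}" "{x m..x (Suc m)} \<subseteq> {0..2*pi}"
      using xmono[OF Suc.prems] xmono[of 0 m] xN by (auto simp: x_def)
    have "integral {0..x (Suc m)} F = integral {0..x m} F + integral {x m..x (Suc m)} F"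
      using xmono[of 0 m] xmono[of m "Suc m"] integrable_on_subinterval[OF Fint sub(1)]
      by (subst Henstock_Kurzweil_Integration.integral_combine[symmetric, where c="x m"]) (auto simp: x_def)
    moreover have "norm (integral {x m..x (Suc m)} F) \<le> C m * measure lborel {x m..x (Suc m)}"
    proof (rule has_integral_bound_real)
      show "(F has_integral integral {x m..x (Suc m)} F) {x m..x (Suc m)}"
        using integrable_on_subinterval[OF Fint sub(2)] by (rule integrable_integral)
      \<comment> \<open>The cell bound excludes the right end, which becomes the exceptional
        set.\<close>
      show "finite {x (Suc m)}" by simp
      show "0 \<le> C m" using C0 Suc.prems by simp
      show "norm (F y) \<le> C m" if "y \<in> {x m..x (Suc m)} - {x (Suc m)}" for y
        using that C[of m y] C0[of m] Suc.prems by (auto simp: F_def x_def add.commute)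
    qed
    moreover have "measure lborel {x m..x (Suc m)} = 2*pi / N"
      using xmono[of m "Suc m"] by (simp add: x_def diff_divide_distrib[symmetric] algebra_simps)
    ultimately show ?case
      using Suc norm_triangle_ineq[of "integral {0..x m} F" "integral {x m..x (Suc m)} F"]
      by (simp add: algebra_simps add_divide_distrib)
  qed
  from this[of N] have "norm (integral {0..2*pi} F) \<le> 2*pi / N * (\<Sum>k<N. C k)" by (simp add: xN)
  also have "integral {0..2*pi} F = integral {0..\<theta>} f"
    unfolding F_def using \<theta> by (subst integral_restrict_Int) (auto simp: min_def)
  finally show ?thesis .
qed

text \<open>A non-integrable function has integral 0 by convention, so a nonnegative integrable
  majorant suffices. This spares integrability proofs for the curvature density and for the speed in
  time.\<close>

lemma integral_mono_nonneg:
  fixes f g :: "real \<Rightarrow> real"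
  assumes "g integrable_on S" "\<And>x. x \<in> S \<Longrightarrow> f x \<le> g x" "\<And>x. x \<in> S \<Longrightarrow> 0 \<le> g x"
  shows "integral S f \<le> integral S g"
proof (cases "f integrable_on S")
  case True then show ?thesis using assms by (intro integral_le) auto
next
  case False then show ?thesis using assms integral_nonneg[of g S] by (simp add: not_integrable_integral)
qed

section \<open>Approximating the turning angle\<close>

definition node :: "nat \<Rightarrow> nat \<Rightarrow> real" where
  "node N k = 2*pi * real k / real N"

lemma node_mono: "k \<le> m \<Longrightarrow> node N k \<le> node N m"
  by (auto simp: node_def intro!: divide_right_mono)

lemma node_nonneg: "0 \<le> node N k"
  by (simp add: node_def)

lemma node_le: "k \<le> N \<Longrightarrow> node N k \<le> 2*pi"
  by (cases "N = 0") (auto simp: node_def field_simps)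

text \<open>\<open>g\<close> acts as a variation function on one period; the jump that periodicity
  may force at \<open>2*pi\<close> is already included in it.\<close>

locale bv_angle =
  fixes \<beta> g :: "real \<Rightarrow> real"
  assumes periodic: "\<beta> (x + 2*pi) = \<beta> x"
    and dominated: "0 \<le> x \<Longrightarrow> x \<le> y \<Longrightarrow> y \<le> 2*pi \<Longrightarrow> \<bar>\<beta> x - \<beta> y\<bar> \<le> g y - g x"
begin

definition total :: real where "total = g (2*pi) - g 0"

definition var :: "nat \<Rightarrow> nat \<Rightarrow> real" where
  "var N k = g (node N (Suc k)) - g (node N k)"

lemma g_mono: "0 \<le> x \<Longrightarrow> x \<le> y \<Longrightarrow> y \<le> 2*pi \<Longrightarrow> g x \<le> g y"
  using dominated[of x y] by linarith

lemma total_nonneg: "0 \<le> total"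
  using g_mono[of 0 "2*pi"] by (simp add: total_def)

lemma var_nonneg: "k < N \<Longrightarrow> 0 \<le> var N k"
  using g_mono[OF node_nonneg node_mono[of k "Suc k"] node_le[of "Suc k" N]] by (simp add: var_def)

lemma sum_var: "N > 0 \<Longrightarrow> (\<Sum>k<N. var N k) = total"
  unfolding var_def total_def by (subst sum_lessThan_telescope) (simp add: node_def)

lemma oscillation_le:
  assumes "0 \<le> a" "b \<le> 2*pi" "x \<in> {a..b}" "y \<in> {a..b}"
  shows "\<bar>\<beta> x - \<beta> y\<bar> \<le> g b - g a"
proof -
  have *: "\<bar>\<beta> x - \<beta> y\<bar> \<le> g b - g a" if "x \<le> y" "x \<in> {a..b}" "y \<in> {a..b}" for x y
    using that assms dominated[of x y] g_mono[of a x] g_mono[of y b] by auto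
  show ?thesis
    using *[of x y] *[of y x] assms by (cases "x \<le> y") (auto simp: abs_minus_commute)
qed

definition step :: "nat \<Rightarrow> real \<Rightarrow> real" where
  "step N x = interp (\<lambda>k. \<beta> (2*pi * of_int k / real N)) (real N * x / (2*pi))"

definition slope :: "nat \<Rightarrow> real \<Rightarrow> real" where
  "slope N x = (let y = real N * x / (2*pi) in smooth_step' (y - \<lfloor>y\<rfloor>) *
    (\<beta> (2*pi * of_int (\<lfloor>y\<rfloor> + 1) / real N) - \<beta> (2*pi * of_int \<lfloor>y\<rfloor> / real N)) * (real N / (2*pi)))"

lemma step_deriv: "(step N has_field_derivative slope N x) (at x)"
proof -
  have d: "((\<lambda>x. real N * x / (2*pi)) has_field_derivative real N / (2*pi)) (at x)"
    by (auto intro!: derivative_eq_intros)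
  show ?thesis
    unfolding step_def[abs_def] slope_def Let_def by (rule DERIV_chain2[OF interp_has_field_derivative d])
qed

lemma smooth2_step: "smooth2_on UNIV (\<lambda>s t. step N t)"
proof -
  have "smooth2_on UNIV (\<lambda>s t. real N / (2*pi) * t)"
    by (intro smooth2_intros)
  then show ?thesis unfolding step_def
    by (intro smooth2_interp smooth2_const) simp
qed

lemma smooth2_slope: "smooth2_on UNIV (\<lambda>s t. slope N t)"
  by (rule smooth2_partial_snd[OF smooth2_step])
    (use step_deriv in \<open>simp add: has_real_derivative_iff_has_vector_derivative\<close>)

lemma slope_continuous: "continuous_on A (slope N)"
  using continuous_on_slice[OF smooth2_elim(1)[OF smooth2_slope]] .

lemma step_periodic:
  assumes "N > 0" shows "step N (x + 2*pi) = step N x"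
proof -
  have "real N * (x + 2*pi) / (2*pi) = real N * x / (2*pi) + of_int (int N)"
    by (simp add: field_simps)
  moreover have "\<beta> (2*pi * of_int (k + int N) / real N) = \<beta> (2*pi * of_int k / real N)" for k
    using periodic[of "2*pi * of_int k / real N"] assms by (simp add: field_simps)
  ultimately show ?thesis unfolding step_def using interp_periodic by presburger
qed

text \<open>The nodes of the \<open>q\<close> times finer grid adjacent to \<open>x\<close> stay in
  the closed coarse cell of \<open>x\<close>, so no further variation enters. Taking
  \<open>q\<close> as 1 and as 4 measures two successive levels on one partition.\<close>

lemma step_close:
  assumes "q > 0" "k < N" and x: "node N k \<le> x" "x < node N (Suc k)"
    and z: "node N k \<le> z" "z \<le> node N (Suc k)"
  shows "\<bar>step (q * N) x - \<beta> z\<bar> \<le> var N k"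
proof -
  define y where "y = real (q * N) * x / (2*pi)"
  have N: "real N > 0" and q: "real q > 0" using assms by auto
  have "real k \<le> real N * x / (2*pi)" "real N * x / (2*pi) < real (Suc k)"
    using x N by (auto simp: node_def field_simps)
  then have "real q * real k \<le> real q * (real N * x / (2*pi))" "real q * (real N * x / (2*pi)) < real q * real (Suc k)"
    using q by (blast intro: mult_left_mono mult_strict_left_mono less_imp_le)+
  then have "real (q * k) \<le> y" "y < real (q * Suc k)"
    by (simp_all only: y_def of_nat_mult times_divide_eq_right mult.assoc)
  then have fl: "int (q * k) \<le> \<lfloor>y\<rfloor>" "\<lfloor>y\<rfloor> + 1 \<le> int (q * Suc k)"
    by linarith+
  have mem: "2*pi * of_int j / real (q * N) \<in> {node N k..node N (Suc k)}"
    if "int (q * k) \<le> j" "j \<le> int (q * Suc k)" for j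
  proof -
    have "real (q * k) \<le> of_int j" "of_int j \<le> real (q * Suc k)"
      using that by linarith+
    moreover have "node N i = 2*pi * real (q * i) / real (q * N)" for i
      using q by (simp add: node_def)
    ultimately show ?thesis by (simp only: atLeastAtMost_iff)
      (intro conjI divide_right_mono mult_left_mono; simp)
  qed
  have *: "\<bar>\<beta> (2*pi * of_int j / real (q * N)) - \<beta> z\<bar> \<le> var N k"
    if "int (q * k) \<le> j" "j \<le> int (q * Suc k)" for j
    unfolding var_def using mem[OF that] z \<open>k < N\<close>
    by (intro oscillation_le node_nonneg node_le) auto
  show ?thesis unfolding step_def y_def[symmetric]
    by (rule interp_close; rule *) (use fl in linarith)+
qed

lemma slope_bound:
  assumes "k < N" "node N k \<le> x" "x < node N (Suc k)"
  shows "\<bar>slope N x\<bar> \<le> real N / (2*pi) * (1 / bump_mass) * var N k"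
proof -
  define y where "y = real N * x / (2*pi)"
  have N: "real N > 0" using assms by auto
  have "\<lfloor>y\<rfloor> = int k"
    using assms N by (intro floor_unique) (auto simp: y_def node_def field_simps)
  then have "slope N x = smooth_step' (y - k) * (\<beta> (node N (Suc k)) - \<beta> (node N k)) * (real N / (2*pi))"
    unfolding slope_def Let_def y_def[symmetric] by (simp add: node_def add.commute)
  also have "\<bar>\<dots>\<bar> \<le> (1 / bump_mass) * var N k * (real N / (2*pi))"
  proof -
    have "\<bar>\<beta> (node N (Suc k)) - \<beta> (node N k)\<bar> \<le> var N k"
      unfolding var_def using node_mono[of k "Suc k" N] assms(1)
      by (intro oscillation_le node_nonneg node_le) auto
    then show ?thesis
      unfolding abs_mult using smooth_step'_bounds[of "y - k"] bump_mass_pos var_nonneg[OF assms(1)]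
      by (intro mult_mono) auto
  qed
  finally show ?thesis by (simp add: ac_simps)
qed

lemma slope_square_integral:
  assumes "N > 0"
  shows "integral {0..2*pi} (\<lambda>x. (slope N x)\<^sup>2) \<le> real N / (2*pi) * (total / bump_mass)\<^sup>2"
proof -
  let ?C = "\<lambda>k. (real N / (2*pi) * (1 / bump_mass) * var N k)\<^sup>2"
  have "norm (integral {0..2*pi} (\<lambda>x. (slope N x)\<^sup>2)) \<le> 2*pi / N * (\<Sum>k<N. ?C k)"
  proof (rule integral_partition_bound[OF assms])
    show "(\<lambda>x. (slope N x)\<^sup>2) integrable_on {0..2*pi}"
      by (intro integrable_continuous_real continuous_intros slope_continuous)
    fix k x assume "k < N" "2*pi * real k / real N \<le> x" "x < 2*pi * real (Suc k) / real N"
    then have "\<bar>slope N x\<bar> \<le> real N / (2*pi) * (1 / bump_mass) * var N k"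
      by (intro slope_bound) (auto simp: node_def)
    then show "norm ((slope N x)\<^sup>2) \<le> ?C k"
      using power_mono[of "\<bar>slope N x\<bar>" _ 2] by simp
  qed auto
  also have "(\<Sum>k<N. ?C k) = (real N / (2*pi) * (1 / bump_mass))\<^sup>2 * (\<Sum>k<N. (var N k)\<^sup>2)"
    unfolding sum_distrib_left by (intro sum.cong refl power_mult_distrib)
  \<comment> \<open>Bounding one factor of each square by \<open>total\<close> and summing the other
    gains a factor N over bounding every square by \<open>total\<close> squared.\<close>
  also have "(\<Sum>k<N. (var N k)\<^sup>2) \<le> (\<Sum>k<N. var N k * total)"
  proof (rule sum_mono)
    fix k assume "k \<in> {..<N}"
    then have "var N k \<le> (\<Sum>k<N. var N k)" using var_nonneg by (intro member_le_sum) auto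
    then show "(var N k)\<^sup>2 \<le> var N k * total"
      using \<open>k \<in> {..<N}\<close> var_nonneg[of k N] sum_var[OF assms]
      by (auto simp: power2_eq_square intro!: mult_left_mono)
  qed
  also have "(\<Sum>k<N. var N k * total) = total\<^sup>2"
    using sum_var[OF assms] by (simp add: sum_distrib_right[symmetric] power2_eq_square)
  finally have "norm (integral {0..2*pi} (\<lambda>x. (slope N x)\<^sup>2))
      \<le> 2*pi / N * ((real N / (2*pi) * (1 / bump_mass))\<^sup>2 * total\<^sup>2)"
    by (simp add: divide_right_mono mult_left_mono)
  also have "\<dots> = real N / (2*pi) * (total / bump_mass)\<^sup>2"
    using assms by (simp add: field_simps power2_eq_square)
  finally show ?thesis by simp
qed

text \<open>\<open>nat\<close> freezes the level at 0 for negative \<open>s\<close>, so the family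
  is smooth on the whole line; the estimates concern nonnegative \<open>s\<close>.\<close>

definition angle :: "real \<Rightarrow> real \<Rightarrow> real" where
  "angle s x = interp (\<lambda>k. step (4 ^ nat k) x) s"

definition angle_s :: "real \<Rightarrow> real \<Rightarrow> real" where
  "angle_s s x = smooth_step' (s - \<lfloor>s\<rfloor>) * (step (4 ^ nat (\<lfloor>s\<rfloor> + 1)) x - step (4 ^ nat \<lfloor>s\<rfloor>) x)"

definition angle_x :: "real \<Rightarrow> real \<Rightarrow> real" where
  "angle_x s x = interp (\<lambda>k. slope (4 ^ nat k) x) s"

lemma smooth2_angle: "smooth2_on UNIV angle"
  unfolding angle_def[abs_def] by (intro smooth2_interp smooth2_step smooth2_fst)

lemma angle_deriv_s: "((\<lambda>s. angle s x) has_vector_derivative angle_s s x) (at s)"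
  unfolding angle_def angle_s_def has_real_derivative_iff_has_vector_derivative[symmetric]
  by (rule interp_has_field_derivative)

lemma angle_deriv_x: "(angle s has_vector_derivative angle_x s x) (at x)"
  unfolding angle_def[abs_def] angle_x_def interp_def has_real_derivative_iff_has_vector_derivative[symmetric]
  by (auto intro!: derivative_eq_intros step_deriv)

lemma smooth2_angle_s: "smooth2_on UNIV angle_s"
  by (rule smooth2_partial_fst[OF smooth2_angle angle_deriv_s])

lemma smooth2_angle_x: "smooth2_on UNIV angle_x"
  by (rule smooth2_partial_snd[OF smooth2_angle angle_deriv_x])

lemma angle_periodic: "angle s (x + 2*pi) = angle s x"
  by (simp add: angle_def step_periodic)

section \<open>Estimates at a fixed real level, on the coarser of its two grids\<close>

context
  fixes s :: real and N :: nat
  assumes s: "0 \<le> s"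
  defines "N \<equiv> 4 ^ nat \<lfloor>s\<rfloor>"
begin

lemma N_pos: "N > 0" by (simp add: N_def)

lemma next_level: "4 ^ nat (\<lfloor>s\<rfloor> + 1) = 4 * N"
  using s by (simp add: N_def nat_add_distrib)

lemma angle_close:
  assumes "k < N" "node N k \<le> x" "x < node N (Suc k)" "node N k \<le> z" "z \<le> node N (Suc k)"
  shows "\<bar>angle s x - \<beta> z\<bar> \<le> var N k"
  unfolding angle_def
  using step_close[of 1 k N x z] step_close[of 4 k N x z] assms
  by (intro interp_close) (simp_all add: next_level N_def[symmetric])

text \<open>Both levels deviate from \<beta> at the left node by at most the cell variation, which
  gives the 2; the other factor bounds the slope of the step.\<close>

lemma angle_s_bound:
  assumes "k < N" "node N k \<le> x" "x < node N (Suc k)"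
  shows "\<bar>angle_s s x\<bar> \<le> 2 / bump_mass * var N k"
proof -
  have "\<bar>step (4 * N) x - step N x\<bar> \<le> 2 * var N k"
    using step_close[of 1 k N x "node N k"] step_close[of 4 k N x "node N k"] assms
      node_mono[of k "Suc k" N] by simp
  then have "\<bar>angle_s s x\<bar> \<le> 1 / bump_mass * (2 * var N k)"
    unfolding angle_s_def abs_mult next_level N_def[symmetric]
    using smooth_step'_bounds[of "s - \<lfloor>s\<rfloor>"] bump_mass_pos
    by (intro mult_mono) auto
  then show ?thesis by simp
qed

text \<open>Between two levels the slope is at most the larger of their slopes in absolute value, so
  its square is at most the sum of the squares; 5 is 1 + 4, from grids with N and 4 N cells.\<close>

lemma angle_x_square_integral:
  "integral {0..2*pi} (\<lambda>x. (angle_x s x)\<^sup>2) \<le> 5 * real N / (2*pi) * (total / bump_mass)\<^sup>2"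
proof -
  have le: "(angle_x s x)\<^sup>2 \<le> (slope N x)\<^sup>2 + (slope (4 * N) x)\<^sup>2" for x
  proof -
    let ?r = "max \<bar>slope N x\<bar> \<bar>slope (4 * N) x\<bar>"
    have "\<bar>angle_x s x - 0\<bar> \<le> ?r" unfolding angle_x_def
      by (rule interp_close) (simp_all add: next_level N_def[symmetric])
    then have "(angle_x s x)\<^sup>2 \<le> ?r\<^sup>2"
      using power_mono[of "\<bar>angle_x s x\<bar>" ?r 2] by simp
    also have "\<dots> \<le> (slope N x)\<^sup>2 + (slope (4 * N) x)\<^sup>2" by (simp add: max_def)
    finally show ?thesis .
  qed
  have int: "(\<lambda>x. (slope M x)\<^sup>2) integrable_on {0..2*pi}" for M
    by (intro integrable_continuous_real continuous_intros slope_continuous)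
  have "integral {0..2*pi} (\<lambda>x. (angle_x s x)\<^sup>2)
      \<le> integral {0..2*pi} (\<lambda>x. (slope N x)\<^sup>2 + (slope (4 * N) x)\<^sup>2)"
    by (intro integral_le integrable_add int le integrable_continuous_real continuous_intros
        continuous_on_slice[OF smooth2_elim(1)[OF smooth2_angle_x]])
  also have "\<dots> = integral {0..2*pi} (\<lambda>x. (slope N x)\<^sup>2) + integral {0..2*pi} (\<lambda>x. (slope (4 * N) x)\<^sup>2)"
    by (rule integral_add[OF int int])
  also have "\<dots> \<le> real N / (2*pi) * (total / bump_mass)\<^sup>2 + real (4 * N) / (2*pi) * (total / bump_mass)\<^sup>2"
    using N_pos by (intro add_mono slope_square_integral) auto
  also have "\<dots> = 5 * real N / (2*pi) * (total / bump_mass)\<^sup>2" by (simp add: field_simps)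
  finally show ?thesis .
qed

end

end

section \<open>Approximating the curve\<close>

lemma norm_exp_i_diff_le: "norm (exp (\<i> * complex_of_real a) - exp (\<i> * complex_of_real b)) \<le> \<bar>a - b\<bar>"
proof -
  have "exp (\<i> * complex_of_real a) - exp (\<i> * complex_of_real b)
      = exp (\<i> * complex_of_real b) * (exp (\<i> * complex_of_real (a - b)) - 1)"
    by (simp add: algebra_simps flip: exp_add)
  then have "norm (exp (\<i> * complex_of_real a) - exp (\<i> * complex_of_real b)) = 2 * \<bar>sin ((a - b) / 2)\<bar>"
    using dist_exp_i_1[of "a - b"] by (simp add: norm_mult)
  also have "\<dots> \<le> \<bar>a - b\<bar>" using abs_sin_x_le_abs_x[of "(a - b) / 2"] by simp
  finally show ?thesis .
qed

text \<open>The linear term is the correction that closes a curve up. It obeys the same bound as the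
  integral itself, so 2 pi becomes 4 pi.\<close>

lemma integral_minus_linear_bound:
  fixes f :: "real \<Rightarrow> complex" and N :: nat and C :: "nat \<Rightarrow> real"
  assumes "N > 0" and "f integrable_on {0..2*pi}"
    and "\<And>k x. k < N \<Longrightarrow> node N k \<le> x \<Longrightarrow> x < node N (Suc k) \<Longrightarrow> norm (f x) \<le> C k"
    and x: "0 \<le> x" "x \<le> 2*pi"
  shows "norm (integral {0..x} f - of_real x * (integral {0..2*pi} f / (2*pi))) \<le> 4*pi / N * (\<Sum>k<N. C k)"
proof -
  let ?K = "2*pi / N * (\<Sum>k<N. C k)"
  have le: "norm (integral {0..y} f) \<le> ?K" if "0 \<le> y" "y \<le> 2*pi" for y
    by (rule integral_partition_bound[OF assms(1,2)]) (use assms(3) that in \<open>auto simp: node_def\<close>)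
  have "norm (of_real x * (integral {0..2*pi} f / (2*pi))) = x / (2*pi) * norm (integral {0..2*pi} f)"
    using x by (simp add: norm_mult norm_divide)
  also have "\<dots> \<le> 1 * ?K"
    using x le[of "2*pi"] by (intro mult_mono) auto
  finally show ?thesis
    using le[OF x] norm_triangle_ineq4[of "integral {0..x} f" "of_real x * (integral {0..2*pi} f / (2*pi))"]
    by simp
qed

lemma abs_detC_le: "\<bar>detC a b\<bar> \<le> cmod a * cmod b"
proof -
  have "detC a b = Im (cnj a * b)" by (simp add: detC_def)
  then show ?thesis using abs_Im_le_cmod[of "cnj a * b"] by (simp add: norm_mult)
qed

text \<open>The a.e. derivative of the curve enters only through this integral identity, in which
  \<rho> is the constant speed.\<close>

locale bv_curve = bv_angle +
  fixes c0 :: "real \<Rightarrow> complex" and \<rho> :: real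
  assumes speed_pos: "\<rho> > 0"
    and c0_periodic: "c0 (x + 2*pi) = c0 x"
    and c0_integral: "0 \<le> x \<Longrightarrow> x \<le> 2*pi \<Longrightarrow>
      ((\<lambda>x. of_real \<rho> * exp (\<i> * of_real (\<beta> x))) has_integral (c0 x - c0 0)) {0..x}"
begin

definition tangent :: "real \<Rightarrow> real \<Rightarrow> complex" where
  "tangent s x = exp (\<i> * of_real (angle s x))"

definition tangent_s :: "real \<Rightarrow> real \<Rightarrow> complex" where
  "tangent_s s x = \<i> * of_real (angle_s s x) * tangent s x"

definition mean :: "real \<Rightarrow> complex" where
  "mean s = primitive tangent s (2*pi) / (2*pi)"

text \<open>Subtracting the mean of the tangent closes the curve up; it destroys the constant speed,
  but the speed stays positive as soon as the mean is shorter than 1.\<close>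
definition curve :: "real \<Rightarrow> real \<Rightarrow> complex" where
  "curve s x = c0 0 + of_real \<rho> * (primitive tangent s x - of_real x * mean s)"

definition curve_s :: "real \<Rightarrow> real \<Rightarrow> complex" where
  "curve_s s x = of_real \<rho> * (primitive tangent_s s x - of_real x * (primitive tangent_s s (2*pi) / (2*pi)))"

definition curve_x :: "real \<Rightarrow> real \<Rightarrow> complex" where
  "curve_x s x = of_real \<rho> * (tangent s x - mean s)"

definition curve_xx :: "real \<Rightarrow> real \<Rightarrow> complex" where
  "curve_xx s x = of_real \<rho> * (\<i> * of_real (angle_x s x) * tangent s x)"

lemma norm_tangent [simp]: "cmod (tangent s x) = 1"
  by (simp add: tangent_def)

lemma smooth2_tangent: "smooth2_on UNIV tangent"
  unfolding tangent_def[abs_def] by (intro smooth2_intros smooth2_angle)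

lemma smooth2_tangent_s: "smooth2_on UNIV tangent_s"
  unfolding tangent_s_def[abs_def] by (intro smooth2_intros smooth2_angle_s smooth2_tangent)

lemma exp_i_vector_derivative:
  assumes "(f has_vector_derivative d) (at x)"
  shows "((\<lambda>x. exp (\<i> * complex_of_real (f x))) has_vector_derivative \<i> * of_real d * exp (\<i> * of_real (f x))) (at x)"
proof -
  have "((\<lambda>x. exp (\<i> * complex_of_real x)) has_vector_derivative \<i> * exp (\<i> * of_real y)) (at y)" for y
    by (rule has_vector_derivative_real_field) (auto intro!: derivative_eq_intros)
  from vector_diff_chain_at[OF assms this] show ?thesis
    by (simp add: o_def scaleR_conv_of_real ac_simps)
qed

lemma tangent_deriv_s: "((\<lambda>s. tangent s x) has_vector_derivative tangent_s s x) (at s)"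
  unfolding tangent_s_def tangent_def by (rule exp_i_vector_derivative[OF angle_deriv_s])

lemma smooth2_mean: "smooth2_on UNIV (\<lambda>s t. mean s)"
proof -
  have "smooth2_on UNIV (\<lambda>s t. primitive tangent s (2*pi) * (1 / (2*pi)))"
    by (intro smooth2_intros smooth2_freeze smooth2_tangent)
  then show ?thesis by (simp add: mean_def)
qed

lemma smooth2_curve: "smooth2_on UNIV curve"
  unfolding curve_def[abs_def] by (intro smooth2_intros smooth2_tangent smooth2_mean)

lemma curve_deriv_x: "(curve s has_vector_derivative curve_x s x) (at x)"
proof -
  have lin: "((\<lambda>x. of_real x * mean s) has_vector_derivative mean s) (at x)"
    using has_vector_derivative_mult_left[OF has_vector_derivative_of_real[OF DERIV_ident]] by simp
  have "((\<lambda>x. c0 0 + of_real \<rho> * (primitive tangent s x - of_real x * mean s)) has_vector_derivative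
      0 + of_real \<rho> * (tangent s x - mean s)) (at x)"
    by (intro has_vector_derivative_add has_vector_derivative_const has_vector_derivative_mult_right
        has_vector_derivative_diff primitive_has_vector_derivative[OF smooth2_tangent] lin)
  then show ?thesis unfolding curve_def[abs_def] curve_x_def by simp
qed

lemma curve_x_deriv_x: "(curve_x s has_vector_derivative curve_xx s x) (at x)"
proof -
  have "(tangent s has_vector_derivative \<i> * of_real (angle_x s x) * tangent s x) (at x)"
    unfolding tangent_def[abs_def] by (rule exp_i_vector_derivative[OF angle_deriv_x])
  then show ?thesis unfolding curve_x_def[abs_def] curve_xx_def
    by (auto intro!: derivative_eq_intros)
qed

lemma curve_deriv_s: "((\<lambda>s. curve s x) has_vector_derivative curve_s s x) (at s)"
proof -
  have P: "((\<lambda>s. primitive tangent s y) has_vector_derivative primitive tangent_s s y) (at s)" for y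
    by (rule primitive_has_vector_derivative_fst[OF smooth2_tangent smooth2_tangent_s tangent_deriv_s])
  have "((\<lambda>s. c0 0 + of_real \<rho> * (primitive tangent s x - of_real x * (primitive tangent s (2*pi) / (2*pi)))) has_vector_derivative
      (0 + of_real \<rho> * (primitive tangent_s s x - of_real x * (primitive tangent_s s (2*pi) / (2*pi))))) (at s)"
    by (intro has_vector_derivative_add has_vector_derivative_const has_vector_derivative_mult_right
        has_vector_derivative_diff has_vector_derivative_divide P)
  then show ?thesis unfolding curve_def curve_s_def mean_def by simp
qed

lemma tangent_periodic: "tangent s (x + 2*pi) = tangent s x"
  by (simp add: tangent_def angle_periodic)

lemma curve_periodic: "curve s (x + 2*pi) = curve s x"
proof -
  have sh: "((\<lambda>x. x + 2*pi) has_vector_derivative 1) (at x)" for x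
    by (auto intro!: derivative_eq_intros)
  have c: "((\<lambda>x. curve s (x + 2*pi)) has_vector_derivative curve_x s x) (at x)" for x
    using vector_diff_chain_at[OF sh curve_deriv_x] by (simp add: o_def curve_x_def tangent_periodic)
  have "((\<lambda>x. curve s (x + 2*pi) - curve s x) has_vector_derivative 0) (at x)" for x
    using has_vector_derivative_diff[OF c curve_deriv_x[of s x]] by simp
  then obtain z where "\<And>x. curve s (x + 2*pi) - curve s x = z"
    using has_vector_derivative_zero_constant[of UNIV "\<lambda>x. curve s (x + 2*pi) - curve s x"] by auto
  \<comment> \<open>At 0 the difference vanishes by the choice of \<open>mean\<close>.\<close>
  from this[of 0] this[of x] show ?thesis by (simp add: curve_def mean_def)
qed

lemma curve_immersion:
  assumes "cmod (mean s) < 1"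
  shows "smooth_immersion (curve s)"
proof -
  have "curve_x s x \<noteq> 0" for x
    using assms speed_pos norm_tangent[of s x] by (auto simp del: norm_tangent simp: curve_x_def)
  then show ?thesis
    unfolding smooth_immersion_def periodic2pi_def
    using curve_periodic smooth2_imp_smooth1[OF smooth2_curve] vector_derivative_at[OF curve_deriv_x]
    by simp
qed

section \<open>Distance to the limit curve and size of the deformation velocity\<close>

definition limit_tangent :: "real \<Rightarrow> complex" where
  "limit_tangent x = exp (\<i> * of_real (\<beta> x))"

lemma limit_tangent_integral:
  assumes "0 \<le> x" "x \<le> 2*pi"
  shows "(limit_tangent has_integral (c0 x - c0 0) / of_real \<rho>) {0..x}"
  using has_integral_mult_right[OF c0_integral[OF assms], of "1 / of_real \<rho>"] speed_pos
  by (simp add: limit_tangent_def[abs_def])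

lemma tangent_integral:
  assumes "0 \<le> x"
  shows "(tangent s has_integral primitive tangent s x) {0..x}"
  by (rule primitive_integral[OF smooth2_tangent assms])

context
  fixes s :: real and N :: nat
  assumes s: "0 \<le> s"
  defines "N \<equiv> 4 ^ nat \<lfloor>s\<rfloor>"
begin

lemma tangent_close:
  assumes "k < N" "node N k \<le> x" "x < node N (Suc k)"
  shows "norm (tangent s x - limit_tangent x) \<le> var N k"
  unfolding tangent_def limit_tangent_def
  using norm_exp_i_diff_le[of "angle s x" "\<beta> x"] angle_close[OF s, of k x x, folded N_def] assms by force

lemma curve_close:
  assumes "0 \<le> x" "x \<le> 2*pi"
  shows "norm (integral {0..x} (\<lambda>x. tangent s x - limit_tangent x)) \<le> 2*pi / N * total"
    and "norm (curve s x - c0 x) \<le> 4*pi*\<rho>*total / N"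
proof -
  let ?f = "\<lambda>x. tangent s x - limit_tangent x"
  have N: "N > 0" by (simp add: N_def)
  have int: "(?f has_integral (primitive tangent s y - (c0 y - c0 0) / of_real \<rho>)) {0..y}"
    if "0 \<le> y" "y \<le> 2*pi" for y
    by (intro has_integral_diff tangent_integral limit_tangent_integral that)
  have fint: "?f integrable_on {0..2*pi}" using int[of "2*pi"] by auto
  show "norm (integral {0..x} ?f) \<le> 2*pi / N * total"
    unfolding sum_var[OF N, symmetric]
    by (rule integral_partition_bound[OF N fint]) (use tangent_close assms in \<open>auto simp: node_def\<close>)
  have "norm (integral {0..x} ?f - of_real x * (integral {0..2*pi} ?f / (2*pi))) \<le> 4*pi / N * (\<Sum>k<N. var N k)"
    by (rule integral_minus_linear_bound[OF N fint]) (use tangent_close assms in auto)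
  then have "\<rho> * norm (integral {0..x} ?f - of_real x * (integral {0..2*pi} ?f / (2*pi))) \<le> \<rho> * (4*pi / N * total)"
    using speed_pos by (intro mult_left_mono) (auto simp: sum_var[OF N])
  \<comment> \<open>\<open>c0\<close> closes up, so \<open>limit_tangent\<close> has mean zero and
    subtracting \<open>mean s\<close> amounts to subtracting the mean of the difference.\<close>
  moreover have "curve s x - c0 x = of_real \<rho> * (integral {0..x} ?f - of_real x * (integral {0..2*pi} ?f / (2*pi)))"
  proof -
    have "integral {0..2*pi} ?f = primitive tangent s (2*pi)"
      using int[of "2*pi", THEN integral_unique] c0_periodic[of 0] by simp
    then show ?thesis unfolding int[OF assms, THEN integral_unique]
      using speed_pos by (simp add: curve_def mean_def right_diff_distrib diff_divide_distrib)
  qed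
  ultimately show "norm (curve s x - c0 x) \<le> 4*pi*\<rho>*total / N"
    using speed_pos by (simp add: norm_mult mult.commute mult.left_commute)
qed

text \<open>As \<open>limit_tangent\<close> has mean zero, the mean of \<open>tangent s\<close> is
  that of their small difference.\<close>

lemma mean_bound: "cmod (mean s) \<le> total / N"
proof -
  let ?f = "\<lambda>x. tangent s x - limit_tangent x"
  have "integral {0..2*pi} ?f = primitive tangent s (2*pi) - (c0 (2*pi) - c0 0) / of_real \<rho>"
    by (intro integral_unique has_integral_diff tangent_integral limit_tangent_integral) auto
  also have "\<dots> = 2*pi * mean s"
    using c0_periodic[of 0] by (simp add: mean_def)
  finally have "2*pi * cmod (mean s) \<le> 2*pi * (total / N)"
    using curve_close(1)[of "2*pi"] by (simp add: norm_mult)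
  then show ?thesis by (rule mult_left_le_imp_le) simp
qed

lemma curve_s_bound:
  assumes "0 \<le> x" "x \<le> 2*pi"
  shows "norm (curve_s s x) \<le> 8*pi*\<rho>*(total / bump_mass) / N"
proof -
  have N: "N > 0" by (simp add: N_def)
  have int: "(tangent_s s has_integral primitive tangent_s s y) {0..y}" if "0 \<le> y" for y
    by (rule primitive_integral[OF smooth2_tangent_s that])
  have bound: "norm (tangent_s s x) \<le> 2 / bump_mass * var N k"
    if "k < N" "node N k \<le> x" "x < node N (Suc k)" for k x
    using angle_s_bound[OF s, of k x, folded N_def] that
    by (simp add: tangent_s_def tangent_def norm_mult)
  have "norm (integral {0..x} (tangent_s s) - of_real x * (integral {0..2*pi} (tangent_s s) / (2*pi)))
      \<le> 4*pi / N * (\<Sum>k<N. 2 / bump_mass * var N k)"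
    by (rule integral_minus_linear_bound[OF N]) (use int[of "2*pi"] bound assms in auto)
  also have "(\<Sum>k<N. 2 / bump_mass * var N k) = 2 / bump_mass * total"
    by (simp only: sum_var[OF N] flip: sum_distrib_left)
  finally have "\<rho> * norm (primitive tangent_s s x - of_real x * (primitive tangent_s s (2*pi) / (2*pi)))
      \<le> \<rho> * (4*pi / N * (2 / bump_mass * total))"
    using speed_pos assms int[THEN integral_unique] by (intro mult_left_mono) auto
  then show ?thesis using speed_pos by (simp add: curve_s_def norm_mult ac_simps)
qed

text \<open>A mean of length at most 1/2 keeps the speed between \<rho>/2 and 2 \<rho>, so the
  curvature is at most 4 |\<open>angle_x\<close>| / \<rho>, and squaring gives the 16. The normal
  component is estimated by the whole velocity; \<open>b\<close> is the rate at which a path runs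
  through the levels.\<close>

lemma density_bound:
  assumes "A > 0" "cmod (mean s) \<le> 1 / 2" "0 \<le> x" "x \<le> 2*pi"
  shows "(1 + A * (detC (curve_x s x) (curve_xx s x) / cmod (curve_x s x) ^ 3)\<^sup>2) *
      (inner (b *\<^sub>R curve_s s x) (\<i> * curve_x s x / complex_of_real (cmod (curve_x s x))))\<^sup>2 * cmod (curve_x s x)
    \<le> (1 + 16 * A / \<rho>\<^sup>2 * (angle_x s x)\<^sup>2) * (\<bar>b\<bar> * (8*pi*\<rho>*(total / bump_mass) / N))\<^sup>2 * (2 * \<rho>)"
proof -
  let ?v = "cmod (curve_x s x)"
  let ?\<kappa> = "detC (curve_x s x) (curve_xx s x) / ?v ^ 3"
  have v: "?v = \<rho> * cmod (tangent s x - mean s)" using speed_pos by (simp add: curve_x_def norm_mult)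
  have "1 / 2 \<le> cmod (tangent s x - mean s)" "cmod (tangent s x - mean s) \<le> 2"
    using norm_triangle_ineq2[of "tangent s x" "mean s"] norm_triangle_ineq4[of "tangent s x" "mean s"] assms(2)
    unfolding norm_tangent
    by linarith+
  then have v_bounds: "\<rho> / 2 \<le> ?v" "?v \<le> 2 * \<rho>" unfolding v using speed_pos by simp_all
  then have v_pos: "0 < ?v" using speed_pos by linarith
  have "\<bar>?\<kappa>\<bar> = \<bar>detC (curve_x s x) (curve_xx s x)\<bar> / ?v ^ 3" by simp
  also have "\<dots> \<le> ?v * (\<rho> * \<bar>angle_x s x\<bar>) / ?v ^ 3"
    using abs_detC_le[of "curve_x s x" "curve_xx s x"] speed_pos
    by (intro divide_right_mono) (auto simp: curve_xx_def norm_mult)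
  also have "\<dots> = \<rho> * \<bar>angle_x s x\<bar> / ?v\<^sup>2"
    using v_pos by (simp add: power2_eq_square power3_eq_cube)
  also have "\<dots> \<le> \<rho> * \<bar>angle_x s x\<bar> / (\<rho> / 2)\<^sup>2"
    using v_bounds v_pos speed_pos by (intro divide_left_mono power_mono mult_nonneg_nonneg mult_pos_pos) auto
  also have "\<dots> = 4 * \<bar>angle_x s x\<bar> / \<rho>"
    using speed_pos by (simp add: power2_eq_square field_simps)
  finally have "\<bar>?\<kappa>\<bar>\<^sup>2 \<le> (4 * \<bar>angle_x s x\<bar> / \<rho>)\<^sup>2" by (intro power_mono) auto
  then have \<kappa>: "?\<kappa>\<^sup>2 \<le> 16 / \<rho>\<^sup>2 * (angle_x s x)\<^sup>2"
    by (simp add: power_divide power_mult_distrib)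
  have "A * ?\<kappa>\<^sup>2 \<le> A * (16 / \<rho>\<^sup>2 * (angle_x s x)\<^sup>2)"
    by (rule mult_left_mono[OF \<kappa>]) (use \<open>A > 0\<close> in simp)
  then have 1: "1 + A * ?\<kappa>\<^sup>2 \<le> 1 + 16 * A / \<rho>\<^sup>2 * (angle_x s x)\<^sup>2" by (simp add: ac_simps)
  let ?i = "inner (b *\<^sub>R curve_s s x) (\<i> * curve_x s x / complex_of_real ?v)"
  have "\<bar>?i\<bar> \<le> norm (b *\<^sub>R curve_s s x) * norm (\<i> * curve_x s x / complex_of_real ?v)"
    by (rule Cauchy_Schwarz_ineq2)
  also have "\<dots> = \<bar>b\<bar> * norm (curve_s s x)"
    using v_pos by (simp add: norm_mult norm_divide)
  also have "\<dots> \<le> \<bar>b\<bar> * (8*pi*\<rho>*(total / bump_mass) / N)"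
    by (intro mult_left_mono curve_s_bound assms) auto
  finally have "\<bar>?i\<bar>\<^sup>2 \<le> (\<bar>b\<bar> * (8*pi*\<rho>*(total / bump_mass) / N))\<^sup>2" by (intro power_mono) auto
  then have 2: "?i\<^sup>2 \<le> (\<bar>b\<bar> * (8*pi*\<rho>*(total / bump_mass) / N))\<^sup>2" by simp
  show ?thesis
    using 1 2 v_bounds \<open>A > 0\<close> by (intro mult_mono mult_nonneg_nonneg add_nonneg_nonneg) auto
qed

end

text \<open>Collects the level-independent factors: \<open>b\<^sup>2 * speed_const A / 4 ^ k\<close>
  bounds the squared horizontal speed at a level with integer part \<open>k\<close>.\<close>

definition speed_const :: "real \<Rightarrow> real" where
  "speed_const A = (8*pi*\<rho>*(total / bump_mass))\<^sup>2 * (2*\<rho>) *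
     (2*pi + 16 * A / \<rho>\<^sup>2 * (5 / (2*pi) * (total / bump_mass)\<^sup>2))"

lemma speed_const_nonneg: "A > 0 \<Longrightarrow> 0 \<le> speed_const A"
  unfolding speed_const_def using speed_pos by (intro mult_nonneg_nonneg add_nonneg_nonneg) auto

lemma density_integral_bound:
  assumes "0 \<le> s" "A > 0"
  shows "integral {0..2*pi} (\<lambda>x. (1 + 16 * A / \<rho>\<^sup>2 * (angle_x s x)\<^sup>2) *
      (\<bar>b\<bar> * (8*pi*\<rho>*(total / bump_mass) / (4 ^ nat \<lfloor>s\<rfloor>)))\<^sup>2 * (2 * \<rho>))
    \<le> (\<bar>b\<bar> * sqrt (speed_const A) * (2 * 2 powr (-s)))\<^sup>2"
proof -
  define k where "k = nat \<lfloor>s\<rfloor>"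
  define W where "W = 8*pi*\<rho>*(total / bump_mass)"
  let ?c = "(\<bar>b\<bar> * (W / 4 ^ k))\<^sup>2 * (2 * \<rho>)"
  have sq: "(\<lambda>x. (angle_x s x)\<^sup>2) integrable_on {0..2*pi}"
    by (intro integrable_continuous_real continuous_intros continuous_on_slice[OF smooth2_elim(1)[OF smooth2_angle_x]])
  have one: "((\<lambda>x. 1::real) has_integral 2*pi) {0..2*pi}"
    using has_integral_const_real[of "1::real" 0 "2*pi"] by simp
  have "integral {0..2*pi} (\<lambda>x. (1 + 16 * A / \<rho>\<^sup>2 * (angle_x s x)\<^sup>2) * ?c)
      = (2*pi + 16 * A / \<rho>\<^sup>2 * integral {0..2*pi} (\<lambda>x. (angle_x s x)\<^sup>2)) * ?c"
    by (intro integral_unique has_integral_mult_left has_integral_add one has_integral_mult_right integrable_integral sq)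
  \<comment> \<open>The arc-length term is inflated by \<open>4 ^ k\<close> so that it combines with
    the curvature term into a single power.\<close>
  also have "\<dots> \<le> (2*pi * 4^k + 16 * A / \<rho>\<^sup>2 * (5 * 4^k / (2*pi) * (total / bump_mass)\<^sup>2)) * ?c"
    using angle_x_square_integral[OF assms(1)] assms(2) speed_pos
    by (intro mult_right_mono add_mono mult_left_mono) (auto simp: k_def)
  also have "\<dots> = b\<^sup>2 * speed_const A / 4 ^ k"
  proof -
    define E where "E = 2*pi + 16 * A / \<rho>\<^sup>2 * (5 / (2*pi) * (total / bump_mass)\<^sup>2)"
    have "2*pi * 4^k + 16 * A / \<rho>\<^sup>2 * (5 * 4^k / (2*pi) * (total / bump_mass)\<^sup>2) = 4^k * E"
      by (simp add: E_def distrib_left)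
    moreover have "4^k * E * ((\<bar>b\<bar> * (W / 4 ^ k))\<^sup>2 * (2 * \<rho>)) = b\<^sup>2 * (W\<^sup>2 * (2 * \<rho>) * E) / 4 ^ k"
      by (simp add: power_mult_distrib power_divide power2_eq_square[of "4 ^ k"])
    ultimately show ?thesis by (simp only: speed_const_def W_def[symmetric] E_def[symmetric])
  qed
  also have "\<dots> = b\<^sup>2 * speed_const A * (1 / 2 ^ k)\<^sup>2"
    by (simp add: power_divide power2_eq_square flip: power_mult_distrib)
  \<comment> \<open>Passing from the integer part of \<open>s\<close> to \<open>s\<close> itself
    costs the factor 2.\<close>
  also have "\<dots> \<le> b\<^sup>2 * speed_const A * (2 * 2 powr (-s))\<^sup>2"
  proof (intro mult_left_mono power_mono)
    have "2 powr s \<le> 2 powr (real k + 1)"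
      using assms(1) by (intro powr_mono) (auto simp: k_def)
    also have "\<dots> = 2 * 2 ^ k" by (simp add: powr_add powr_realpow)
    finally show "1 / 2 ^ k \<le> 2 * 2 powr (-s)" by (simp add: powr_minus field_simps)
  qed (use speed_const_nonneg[OF assms(2)] in auto)
  also have "\<dots> = (\<bar>b\<bar> * sqrt (speed_const A) * (2 * 2 powr (-s)))\<^sup>2"
    using speed_const_nonneg[OF assms(2)] by (simp add: power_mult_distrib)
  finally show ?thesis by (simp add: k_def W_def mult.assoc)
qed

text \<open>\<open>J\<close> is a level from which the mean is short, \<open>r\<close> a lower bound
  for both ends of the segment. The sign of \<open>b\<close> is free because the Cauchy property
  tests pairs in either order.\<close>

lemma L_hor_bound:
  assumes A: "A > 0" and J: "0 \<le> J" "J \<le> a" "J \<le> a + b" and mean: "\<And>s. J \<le> s \<Longrightarrow> cmod (mean s) \<le> 1 / 2"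
    and r: "r \<le> a" "r \<le> a + b"
  shows "L_hor A (\<lambda>t. curve (a + b * t)) \<le> 2 * sqrt (speed_const A) / ln 2 * 2 powr (-r)"
proof -
  let ?p = "\<lambda>t. curve (a + b * t)"
  define S where "S = sqrt (speed_const A)"
  have S: "0 \<le> S" using speed_const_nonneg[OF A] by (simp add: S_def)
  have sJ: "J \<le> a + b * t" if "t \<in> {0..1}" for t
  proof -
    have "(1 - t) * J + t * J \<le> (1 - t) * a + t * (a + b)"
      using that J by (intro add_mono mult_left_mono) auto
    then show ?thesis by (simp add: algebra_simps)
  qed
  have dx: "d_theta ?p = (\<lambda>t. curve_x (a + b * t))"
    by (intro ext) (simp add: d_theta_def vector_derivative_at[OF curve_deriv_x])
  have dxx: "d_theta (\<lambda>t. curve_x (a + b * t)) = (\<lambda>t. curve_xx (a + b * t))"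
    by (intro ext) (simp add: d_theta_def vector_derivative_at[OF curve_x_deriv_x])
  have lin: "((\<lambda>t. a + b * t) has_vector_derivative b) (at t)" for t
    by (auto intro!: derivative_eq_intros)
  have dt: "d_t ?p t x = b *\<^sub>R curve_s (a + b * t) x" for t x
    unfolding d_t_def using vector_diff_chain_at[OF lin curve_deriv_s] by (intro vector_derivative_at) (simp add: o_def)
  have speed: "sqrt (integral {0..2*pi} (\<lambda>x. (1 + A * (curvature ?p t x)\<^sup>2) * (inner (d_t ?p t x) (normal ?p t x))\<^sup>2
        * cmod (d_theta ?p t x))) \<le> \<bar>b\<bar> * S * (2 * 2 powr (-(a + b * t)))" if t: "t \<in> {0..1}" for t
  proof -
    let ?s = "a + b * t"
    have s: "0 \<le> ?s" and m: "cmod (mean ?s) \<le> 1 / 2" using sJ[OF t] J(1) mean[of ?s] by auto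
    let ?G = "\<lambda>x. (1 + 16 * A / \<rho>\<^sup>2 * (angle_x ?s x)\<^sup>2) *
      (\<bar>b\<bar> * (8*pi*\<rho>*(total / bump_mass) / (4 ^ nat \<lfloor>?s\<rfloor>)))\<^sup>2 * (2 * \<rho>)"
    have "integral {0..2*pi} (\<lambda>x. (1 + A * (curvature ?p t x)\<^sup>2) * (inner (d_t ?p t x) (normal ?p t x))\<^sup>2
        * cmod (d_theta ?p t x)) \<le> integral {0..2*pi} ?G"
      unfolding curvature_def normal_def dt dx dxx
    proof (rule integral_mono_nonneg)
      show "?G integrable_on {0..2*pi}"
        by (intro integrable_continuous_real continuous_intros continuous_on_slice[OF smooth2_elim(1)[OF smooth2_angle_x]])
      show "0 \<le> ?G x" for x using A speed_pos by simp
    qed (use density_bound[OF s A m] in auto)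
    also have "\<dots> \<le> (\<bar>b\<bar> * S * (2 * 2 powr (-?s)))\<^sup>2"
      unfolding S_def by (rule density_integral_bound[OF s A])
    finally show ?thesis using S by (intro real_le_lsqrt) auto
  qed
  \<comment> \<open>The factor \<open>sgn b\<close> makes one antiderivative serve rising, falling
    and constant levels.\<close>
  let ?F = "\<lambda>t. - sgn b * 2 * S / ln 2 * 2 powr (-(a + b * t))"
  have F: "((\<lambda>t. \<bar>b\<bar> * S * (2 * 2 powr (-(a + b * t)))) has_integral (?F 1 - ?F 0)) {0..1}"
  proof (rule fundamental_theorem_of_calculus)
    fix t
    have "(?F has_field_derivative \<bar>b\<bar> * S * (2 * 2 powr (-(a + b * t)))) (at t)"
      by (auto intro!: derivative_eq_intros simp: abs_sgn powr_def)
    then show "(?F has_vector_derivative \<bar>b\<bar> * S * (2 * 2 powr (-(a + b * t)))) (at t within {0..1})"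
      by (simp add: has_real_derivative_iff_has_vector_derivative has_vector_derivative_at_within)
  qed simp
  have "L_hor A ?p \<le> integral {0..1} (\<lambda>t. \<bar>b\<bar> * S * (2 * 2 powr (-(a + b * t))))"
    unfolding L_hor_def using F S speed by (intro integral_mono_nonneg) auto
  also have "\<dots> = ?F 1 - ?F 0" using F by (rule integral_unique)
  also have "\<dots> = 2 * S / ln 2 * (sgn b * (2 powr (-a) - 2 powr (-(a + b))))"
    by (simp add: algebra_simps)
  also have "\<dots> \<le> 2 * S / ln 2 * 2 powr (-r)"
  proof (intro mult_left_mono)
    have "2 powr (-a) \<le> 2 powr (-r)" "2 powr (-(a + b)) \<le> 2 powr (-r)"
      using r by (auto intro!: powr_mono)
    \<comment> \<open>At most one of the two terms counts positively, hence no doubling of the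
      bound.\<close>
    moreover have "sgn b * (u - v) \<le> w" if "0 \<le> u" "0 \<le> v" "u \<le> w" "v \<le> w" for u v w :: real
      using that by (auto simp: sgn_if)
    ultimately show "sgn b * (2 powr (-a) - 2 powr (-(a + b))) \<le> 2 powr (-r)"
      by (simp only: powr_ge_zero)
  qed (use S in auto)
  finally show ?thesis by (simp add: S_def)
qed

end

section \<open>Distances\<close>

lemma periodic2pi_int:
  assumes "periodic2pi c" shows "c (x + 2*pi * of_int k) = c x"
proof -
  have nat: "c (x + 2*pi * real n) = c x" for x n
  proof (induction n)
    case (Suc n)
    have "c (x + 2*pi * real (Suc n)) = c ((x + 2*pi * real n) + 2*pi)" by (simp add: algebra_simps)
    with Suc assms show ?case unfolding periodic2pi_def by metis
  qed simp
  show ?thesis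
  proof (cases "k \<ge> 0")
    case True
    then show ?thesis using nat[of x "nat k"] by simp
  next
    case False
    then show ?thesis using nat[of "x + 2*pi * of_int k" "nat (-k)"] by simp
  qed
qed

text \<open>One \<open>y\<close> serves all periodic functions at once, so two curves can be
  compared at the same reduced parameter.\<close>

lemma periodic2pi_reduce:
  obtains y where "0 \<le> y" "y < 2*pi" "\<And>c::real \<Rightarrow> 'a. periodic2pi c \<Longrightarrow> c x = c y"
proof
  let ?y = "x - 2*pi * \<lfloor>x / (2*pi)\<rfloor>"
  show "0 \<le> ?y" "?y < 2*pi"
    using floor_divide_lower[of "2*pi" x] floor_divide_upper[of "2*pi" x]
    by (auto simp: algebra_simps)
  show "c x = c ?y" if "periodic2pi c" for c :: "real \<Rightarrow> 'a"
    using periodic2pi_int[OF that, of ?y "\<lfloor>x / (2*pi)\<rfloor>"] by simp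
qed

lemma periodic2pi_bounded:
  fixes c :: "real \<Rightarrow> 'a::metric_space"
  assumes c: "periodic2pi c" and "continuous_on UNIV c"
  shows "bounded (range c)"
proof -
  have "range c \<subseteq> c ` {0..2*pi}"
  proof
    fix z assume "z \<in> range c"
    then obtain x where "z = c x" by blast
    moreover obtain y where "0 \<le> y" "y < 2*pi" "c x = c y" using periodic2pi_reduce[of x] c by metis
    ultimately show "z \<in> c ` {0..2*pi}" by auto
  qed
  moreover have "compact (c ` {0..2*pi})"
    using assms(2) by (intro compact_continuous_image) (auto intro: continuous_on_subset)
  ultimately show ?thesis using bounded_subset compact_imp_bounded by blast
qed

text \<open>\<open>frechet_dist\<close> reads a curve through \<open>Arg\<close>, which alters the
  parameter only by a multiple of 2 pi.\<close>

lemma periodic2pi_Arg_cis: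
  assumes "periodic2pi c" shows "c (Arg (cis x)) = c x"
proof -
  have "cis (Arg (cis x)) = cis x" by (subst cis_Arg) (auto simp: sgn_div_norm)
  then have "sin (Arg (cis x)) = sin x \<and> cos (Arg (cis x)) = cos x"
    by (metis cis.sel)
  then obtain n :: int where "Arg (cis x) = x + 2*pi * n"
    using sin_cos_eq_iff by blast
  then show ?thesis using periodic2pi_int[OF assms] by simp
qed

text \<open>The upper bound tests the identity homeomorphism. Boundedness of both curves makes the
  real suprema genuine, and nonnegativity does the same for the infimum.\<close>

lemma frechet_dist_bounds:
  assumes c: "periodic2pi c" and bdd: "bounded (range c)" "bounded (range d)"
    and B: "\<And>x. cmod (c x - d x) \<le> B"
  shows "0 \<le> frechet_dist c d" "frechet_dist c d \<le> B"
proof -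
  let ?H = "{h::complex \<Rightarrow> complex. \<exists>h'. homeomorphism (sphere 0 1) (sphere 0 1) h h'}"
  let ?S = "\<lambda>h. SUP x. cmod (c (Arg (h (cis x))) - d x)"
  obtain K1 K2 where K: "\<And>x. cmod (c x) \<le> K1" "\<And>x. cmod (d x) \<le> K2"
    using bdd by (auto simp: bounded_iff)
  have above: "bdd_above (range (\<lambda>x. cmod (c (Arg (h (cis x))) - d x)))" for h :: "complex \<Rightarrow> complex"
    unfolding bdd_above_def using K order.trans[OF norm_triangle_ineq4 add_mono] by blast
  have nonneg: "0 \<le> ?S h" for h
    by (rule order.trans[OF norm_ge_zero cSUP_upper[OF UNIV_I above]])
  have id: "(\<lambda>z. z) \<in> ?H"
    using homeomorphism_ident by blast
  show "0 \<le> frechet_dist c d"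
    unfolding frechet_dist_def by (rule cINF_greatest) (use id nonneg in blast)+
  have "frechet_dist c d \<le> ?S (\<lambda>z. z)"
    unfolding frechet_dist_def
    by (rule cINF_lower[OF _ id]) (use nonneg in \<open>auto simp: bdd_below_def\<close>)
  also have "\<dots> \<le> B"
    by (rule cSUP_least) (use B periodic2pi_Arg_cis[OF c] in auto)
  finally show "frechet_dist c d \<le> B" .
qed

lemma orbit_refl: "c \<in> orbit c"
proof -
  have "smooth1_on UNIV (\<lambda>x::real. x)"
    using smooth2_imp_smooth1[OF smooth2_snd] .
  then have "(\<lambda>x. x) \<in> diff_S1" by (simp add: diff_S1_def)
  then show ?thesis unfolding orbit_def by (auto intro!: exI[of _ "\<lambda>x. x"] simp: o_def)
qed

context bv_curve
begin

text \<open>The path is the family itself along the affine segment from \<open>a\<close> to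
  \<open>b\<close>, each end representing its own orbit.\<close>

lemma dist_GA_curve_bound:
  assumes A: "A > 0" and J: "0 \<le> J" "J \<le> a" "J \<le> b" and mean: "\<And>s. J \<le> s \<Longrightarrow> cmod (mean s) \<le> 1 / 2"
    and r: "r \<le> a" "r \<le> b"
  shows "dist_GA A (curve a) (curve b) \<le> ereal (2 * sqrt (speed_const A) / ln 2 * 2 powr (-r))"
proof -
  let ?p = "\<lambda>t. curve (a + (b - a) * t)"
  have ge: "J \<le> a + (b - a) * t" if "t \<in> {0..1}" for t
  proof -
    have "(1 - t) * J + t * J \<le> (1 - t) * a + t * b"
      using that J by (intro add_mono mult_left_mono) auto
    then show ?thesis by (simp add: algebra_simps)
  qed
  have "smooth_immersion (?p t)" if "t \<in> {0..1}" for t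
    using mean[OF ge[OF that]] by (intro curve_immersion) linarith
  then have "smooth_imm_path ?p"
    unfolding smooth_imm_path_def using smooth2_reparam[OF smooth2_curve]
    by (intro conjI exI[of _ UNIV] ballI) auto
  then have "dist_GA A (curve a) (curve b) \<le> ereal (L_hor A ?p)"
    unfolding dist_GA_def using orbit_refl by (intro Inf_lower CollectI exI[of _ ?p]) auto
  also have "L_hor A ?p \<le> 2 * sqrt (speed_const A) / ln 2 * 2 powr (-r)"
    using assms by (intro L_hor_bound[where J=J]) auto
  finally show ?thesis by simp
qed

lemma powr_tail_tendsto_0: "(\<lambda>n. C * 2 powr (- real n)) \<longlonglongrightarrow> 0"
proof -
  have "(\<lambda>n. C * (1 / 2) ^ n) \<longlonglongrightarrow> C * 0" by (intro tendsto_intros) auto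
  moreover have "2 powr (- real n) = (1 / 2) ^ n" for n
    by (simp add: powr_minus powr_realpow power_one_over inverse_eq_divide)
  ultimately show ?thesis by simp
qed

lemma approximation:
  assumes A: "A > 0" and cont: "continuous_on UNIV c0"
  shows "\<exists>c :: nat \<Rightarrow> real \<Rightarrow> complex. (\<forall>n. smooth_immersion (c n)) \<and>
     (\<forall>\<epsilon>>0. \<exists>N. \<forall>m\<ge>N. \<forall>n\<ge>N. dist_GA A (c m) (c n) < ereal \<epsilon>) \<and>
     (\<lambda>n. frechet_dist (c n) c0) \<longlonglongrightarrow> 0"
proof -
  \<comment> \<open>From level \<open>J\<close> on the mean has length at most 1/2, which yields
    immersions and makes the density bound available.\<close>
  obtain J :: nat where J: "2 * total \<le> 2 ^ J"
    using real_arch_pow[of 2 "2 * total"] by (auto dest: less_imp_le)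
  have J4: "2 * total \<le> 4 ^ J * 1"
    using J power_mono[of 2 "4::real" J] by linarith
  have mean_half: "cmod (mean s) \<le> 1 / 2" if "real J \<le> s" for s
  proof -
    have "(4::real) ^ J \<le> 4 ^ nat \<lfloor>s\<rfloor>"
      using that by (intro power_increasing) (auto simp: le_nat_floor)
    then have "2 * total \<le> 4 ^ nat \<lfloor>s\<rfloor>" using J4 by linarith
    then have "total / 4 ^ nat \<lfloor>s\<rfloor> \<le> 1 / 2" by (simp add: field_simps)
    moreover have "cmod (mean s) \<le> total / 4 ^ nat \<lfloor>s\<rfloor>"
      using mean_bound[of s] that by simp
    ultimately show ?thesis by (rule order.trans[rotated])
  qed
  define c where "c n = curve (real (J + n))" for n
  show ?thesis
  proof (intro exI[of _ c] conjI allI impI)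
    have "cmod (mean (real (J + n))) < 1" for n
      using mean_half[of "real (J + n)"] by simp
    then show imm: "smooth_immersion (c n)" for n
      unfolding c_def by (rule curve_immersion)
    fix \<epsilon> :: real assume "\<epsilon> > 0"
    from order_tendstoD(2)[OF powr_tail_tendsto_0[of "2 * sqrt (speed_const A) / ln 2"] this]
    obtain N where N: "2 * sqrt (speed_const A) / ln 2 * 2 powr (- real N) < \<epsilon>"
      unfolding eventually_sequentially by blast
    have "dist_GA A (c m) (c n) \<le> ereal (2 * sqrt (speed_const A) / ln 2 * 2 powr (- real N))"
      if "m \<ge> N" "n \<ge> N" for m n
      unfolding c_def using that A mean_half by (intro dist_GA_curve_bound[where J="real J"]) auto
    from le_less_trans[OF this] N show "\<exists>N. \<forall>m\<ge>N. \<forall>n\<ge>N. dist_GA A (c m) (c n) < ereal \<epsilon>"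
      by (intro exI[of _ N]) simp
  next
    have per: "periodic2pi (c n)" "periodic2pi c0" for n
      using curve_periodic c0_periodic by (auto simp: c_def periodic2pi_def)
    have le: "cmod (c n x - c0 x) \<le> 4*pi*\<rho>*total * 2 powr (- real n)" for n x
    proof -
      obtain y where y: "0 \<le> y" "y < 2*pi" "c n x = c n y" "c0 x = c0 y"
        using periodic2pi_reduce[of x] per by metis
      have "cmod (c n y - c0 y) \<le> 4*pi*\<rho>*total / 4 ^ (J + n)"
        using curve_close(2)[of "real (J + n)" y] y
        by (simp add: c_def nat_int_add)
      \<comment> \<open>Weakened to the rate \<open>2 ^ n\<close> so that the limit already used for
        the distances applies.\<close>
      also have "\<dots> \<le> 4*pi*\<rho>*total / 2 ^ n"
      proof (rule divide_left_mono)
        have "(2::real) ^ n \<le> 4 ^ n" by (rule power_mono) auto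
        also have "\<dots> \<le> 4 ^ (J + n)" by (rule power_increasing) auto
        finally show "(2::real) ^ n \<le> 4 ^ (J + n)" .
      qed (use speed_pos total_nonneg in auto)
      finally show ?thesis using y by (simp add: powr_minus powr_realpow divide_inverse)
    qed
    have "continuous_on UNIV (c n)" for n
      unfolding c_def by (rule continuous_on_slice[OF smooth2_elim(1)[OF smooth2_curve]])
    then have "bounded (range (c n))" "bounded (range c0)" for n
      using periodic2pi_bounded per cont by blast+
    note * = frechet_dist_bounds[OF per(1) this le]
    show "(\<lambda>n. frechet_dist (c n) c0) \<longlonglongrightarrow> 0"
      by (rule tendsto_sandwich[OF _ _ tendsto_const powr_tail_tendsto_0[of "4*pi*\<rho>*total"]]) (use * in auto)
  qed
qed

end

theorem theorem3p11:
  fixes A :: real and c0 :: "real \<Rightarrow> complex" and L :: real and \<alpha> :: "real \<Rightarrow> real"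
  assumes "A > 0"
    and "periodic2pi c0"
    and "\<exists>C. lipschitz_on C UNIV c0"
    and "\<exists>x y. c0 x \<noteq> c0 y"
    and "L = integral {0..2*pi} (\<lambda>\<theta>. cmod (vector_derivative c0 (at \<theta>)))"
    and "locally_bv \<alpha>"
    and "\<forall>\<theta>. \<exists>k::int. \<alpha> (\<theta> + 2*pi) - \<alpha> \<theta> = 2*pi*k"
    and "AE \<theta> in lborel. (c0 has_vector_derivative
            (complex_of_real (L / (2*pi)) * exp (\<i> * complex_of_real (\<alpha> \<theta>)))) (at \<theta>)"
  shows "\<exists>c :: nat \<Rightarrow> real \<Rightarrow> complex. (\<forall>n. smooth_immersion (c n)) \<and>
     (\<forall>\<epsilon>>0. \<exists>N. \<forall>m\<ge>N. \<forall>n\<ge>N. dist_GA A (c m) (c n) < ereal \<epsilon>) \<and>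
     (\<lambda>n. frechet_dist (c n) c0) \<longlonglongrightarrow> 0"
proof -
  obtain C where lip: "C-lipschitz_on UNIV c0" using assms(3) by blast
  define \<rho> where "\<rho> = L / (2*pi)"
  have int: "((\<lambda>x. of_real \<rho> * exp (\<i> * of_real (\<alpha> x))) has_integral (c0 x - c0 0)) {0..x}" if "0 \<le> x" for x
    unfolding \<rho>_def by (rule lipschitz_has_integral_derivative[OF lip assms(8) that])
  have "0 \<le> L"
    unfolding assms(5) by (cases "(\<lambda>\<theta>. cmod (vector_derivative c0 (at \<theta>))) integrable_on {0..2*pi}")
      (auto intro: integral_nonneg simp: not_integrable_integral)
  \<comment> \<open>Zero speed would make \<open>c0\<close> constant, by the integral identity and
    periodicity.\<close>
  moreover have "L \<noteq> 0"
  proof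
    assume "L = 0"
    then have "c0 x = c0 0" if "0 \<le> x" for x
      using int[OF that] by (simp add: \<rho>_def has_integral_0_eq)
    then have "c0 x = c0 0" for x
      using periodic2pi_reduce[of x] assms(2) by metis
    then show False using assms(4) by metis
  qed
  ultimately have \<rho>: "\<rho> > 0" by (simp add: \<rho>_def)
  obtain g where g: "\<And>x y. 0 \<le> x \<Longrightarrow> x \<le> y \<Longrightarrow> y \<le> 2*pi \<Longrightarrow> \<bar>\<alpha> x - \<alpha> y\<bar> \<le> g y - g x"
    using bv_on_dominated assms(6) unfolding locally_bv_def by metis
  \<comment> \<open>\<beta> restarts \<alpha> at every multiple of 2 pi, so the increment over a
    period becomes a jump there.\<close>
  define \<beta> where "\<beta> x = \<alpha> (x - 2*pi * \<lfloor>x / (2*pi)\<rfloor>)" for x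
  \<comment> \<open>The jump is charged to the single point \<open>2*pi\<close>, which dominates it
    for every smaller \<open>x\<close>.\<close>
  define h where "h x = (if x = 2*pi then g x + \<bar>\<alpha> (2*pi) - \<alpha> 0\<bar> else g x)" for x
  have \<beta>_eq: "\<beta> x = \<alpha> x" if "0 \<le> x" "x < 2*pi" for x
  proof -
    have "\<lfloor>x / (2*pi)\<rfloor> = 0" using that by (intro floor_unique) auto
    then show ?thesis by (simp add: \<beta>_def)
  qed
  have \<beta>_2pi: "\<beta> (2*pi) = \<alpha> 0" by (simp add: \<beta>_def)
  interpret bv_curve \<beta> h c0 \<rho>
  proof
    show "\<beta> (x + 2*pi) = \<beta> x" for x
      by (simp add: \<beta>_def add_divide_distrib algebra_simps)
    show "\<bar>\<beta> x - \<beta> y\<bar> \<le> h y - h x" if xy: "0 \<le> x" "x \<le> y" "y \<le> 2*pi" for x y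
    proof -
      consider "y < 2*pi" | "y = 2*pi" "x < 2*pi" | "x = 2*pi" "y = 2*pi" using xy by linarith
      then show ?thesis
      proof cases
        case 1
        then show ?thesis using g[OF xy] xy by (simp add: h_def \<beta>_eq)
      next
        case 2
        then show ?thesis using g[OF xy] xy by (simp add: h_def \<beta>_eq \<beta>_2pi)
      qed simp
    qed
    show "\<rho> > 0" by (rule \<rho>)
    show "c0 (x + 2*pi) = c0 x" for x using assms(2) by (simp add: periodic2pi_def)
    \<comment> \<open>On \<open>{0..2*pi}\<close> the two angles can differ only at
      \<open>2*pi\<close>, a single point.\<close>
    show "((\<lambda>x. of_real \<rho> * exp (\<i> * of_real (\<beta> x))) has_integral (c0 x - c0 0)) {0..x}"
      if "0 \<le> x" "x \<le> 2*pi" for x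
      by (rule has_integral_spike_finite[OF _ _ int[OF that(1)], of "{2*pi}"])
        (use that in \<open>auto simp: \<beta>_eq\<close>)
  qed
  show ?thesis
    using assms(1) lipschitz_on_continuous_on[OF lip] by (rule approximation)
qed

end
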